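(* Let $f\colon\mathbf{R}^n\to\overline{\mathbf{R}}$ be a proper, stratifiable function that is finite at $\bar x$. Suppose that $f$ is directionally Lipschitzian at all points of $\operatorname{dom} f$ near $\bar x$, and is continuous near $\bar x$ relative to $\operatorname{dom} f$ (i.e. there is a neighborhood $U$ of $\bar x$ such that $f|_{\operatorname{dom} f}$ is continuous at every point of $U\cap\operatorname{dom} f$). Then for any dense subset $\Omega$ of $\operatorname{dom} f$, $$\partial_c f(\bar x)=\Big(\bigcap_{\delta>0}\operatorname{cl}\operatorname{conv}\big(\nabla f(\Omega\cap B_\delta(\bar x))\big)\Big)+N^{c}_{\operatorname{dom} f}(\bar x).$$
   Context: Notation: $\overline{\mathbf{R}}=\mathbf{R}\cup\{\pm\infty\}$; $f$ is proper if it never equals $-\infty$ and is not identically $+\infty$; $\operatorname{dom} f=\{x: f(x)<+\infty\}$; $\operatorname{epi} f=\{(x,r): r\ge f(x)\}$; $B_\delta(\bar x)$ is the open ball of radius $\delta$; $\nabla f(A)$ denotes the set of gradients $\nabla f(x)$ over those $x\in A$ at which $f$ is differentiable; $\operatorname{conv}\emptyset=\emptyset$. Normal cones: for $Q\subset\mathbf{R}^n$ and $x\in Q$, the Fréchet normal cone $\hat N_Q(x)$ is the set of $v$ with $\langle v,y-x\rangle\le o(|y-x|)$ as $y\to x$ in $Q$; the limiting normal cone $N_Q(x)$ is the set of all limits $\lim v_i$ with $v_i\in\hat N_Q(x_i)$, $x_i\to x$, $x_i\in Q$; the Clarke normal cone is $N^c_Q(x)=\operatorname{cl}\operatorname{conv}N_Q(x)$.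 Subdifferentials (at $x$ with $f(x)$ finite): $\partial_c f(x)=\{v:(v,-1)\in N^c_{\operatorname{epi} f}(x,f(x))\}$ and $\partial^\infty f(x)=\{v:(v,0)\in N_{\operatorname{epi} f}(x,f(x))\}$. Directionally Lipschitzian: $f$ is directionally Lipschitzian at $x$ (with $f(x)$ finite) if $f$ is locally lower semicontinuous at $x$ (equivalently, $\operatorname{epi} f$ is locally closed at $(x,f(x))$) and the cone $\partial^\infty f(x)$ is pointed, where a cone $K$ is pointed if no finite family of vectors in $K$, not all zero, sums to $0$. Equivalently: $\operatorname{epi} f$ is locally closed at $(x,f(x))$ and $N^c_{\operatorname{epi} f}(x,f(x))$ contains no line. Stratifiable: a locally finite stratification of a set $Q\subset\mathbf{R}^n$ is a partition of $Q$ into disjoint ($\mathbf{C}^2$-)submanifolds $M_i$ of $\mathbf{R}^n$ (strata) such that the closure of each $M_i$ in $Q$ is a union of some of the $M_j$, and each point of $Q$ has a neighborhood meeting only finitely many strata. $f$ is stratifiable if $\operatorname{dom} f$ has a locally finite stratification such that $f$ is $\mathbf{C}^2$-smooth on each stratum, i.e. near each point of the stratum $f$ agrees on the stratum with a $\mathbf{C}^2$ function on $\mathbf{R}^n$. *)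

theory Defs
  imports "HOL-Analysis.Analysis"
begin

section \<open>Normal cones\<close>

text \<open>
  All three cones are only meaningful at points of the set; the limiting and Frechet cones
  (hence also the Clarke cone) are empty elsewhere.
\<close>

definition frechet_normal_cone :: "'a::euclidean_space set \<Rightarrow> 'a \<Rightarrow> 'a set" where
  "frechet_normal_cone Q x =
    {v. x \<in> Q \<and>
        (\<forall>\<epsilon>>0. \<exists>\<delta>>0. \<forall>y\<in>Q. norm (y - x) < \<delta> \<longrightarrow> v \<bullet> (y - x) \<le> \<epsilon> * norm (y - x))}"

definition limiting_normal_cone :: "'a::euclidean_space set \<Rightarrow> 'a \<Rightarrow> 'a set" where
  "limiting_normal_cone Q x =
    {v. x \<in> Q \<and>
        (\<exists>X V. (\<forall>i::nat. X i \<in> Q \<and> V i \<in> frechet_normal_cone Q (X i)) \<and>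
               X \<longlonglongrightarrow> x \<and> V \<longlonglongrightarrow> v)}"

definition clarke_normal_cone :: "'a::euclidean_space set \<Rightarrow> 'a \<Rightarrow> 'a set" where
  "clarke_normal_cone Q x = closure (convex hull (limiting_normal_cone Q x))"


section \<open>Extended-real-valued functions\<close>

definition proper_function :: "('a \<Rightarrow> ereal) \<Rightarrow> bool" where
  "proper_function f \<longleftrightarrow> (\<forall>x. f x \<noteq> -\<infinity>) \<and> (\<exists>x. f x \<noteq> \<infinity>)"

definition effective_domain :: "('a \<Rightarrow> ereal) \<Rightarrow> 'a set" where
  "effective_domain f = {x. f x < \<infinity>}"

definition ereal_epigraph :: "('a \<Rightarrow> ereal) \<Rightarrow> ('a \<times> real) set" where
  "ereal_epigraph f = {(x, r). f x \<le> ereal r}"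

text \<open>
  The subdifferentials are defined at points where \<open>f\<close> is finite and are empty elsewhere.
\<close>

definition clarke_subdifferential :: "('a::euclidean_space \<Rightarrow> ereal) \<Rightarrow> 'a \<Rightarrow> 'a set" where
  "clarke_subdifferential f x =
    {v. \<bar>f x\<bar> \<noteq> \<infinity> \<and>
        (v, -1) \<in> clarke_normal_cone (ereal_epigraph f) (x, real_of_ereal (f x))}"

definition horizon_subdifferential :: "('a::euclidean_space \<Rightarrow> ereal) \<Rightarrow> 'a \<Rightarrow> 'a set" where
  "horizon_subdifferential f x =
    {v. \<bar>f x\<bar> \<noteq> \<infinity> \<and>
        (v, 0) \<in> limiting_normal_cone (ereal_epigraph f) (x, real_of_ereal (f x))}"

text \<open>
  Since \<open>real_of_ereal\<close> sends infinite values to \<open>0\<close>, differentiability of \<open>f\<close> at \<open>x\<close> must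
  require explicitly that \<open>f\<close> is finite on a neighbourhood of \<open>x\<close>.
\<close>

definition gradients :: "('a::euclidean_space \<Rightarrow> ereal) \<Rightarrow> 'a set \<Rightarrow> 'a set" where
  "gradients f A =
    {v. \<exists>x\<in>A. (\<forall>\<^sub>F y in nhds x. \<bar>f y\<bar> \<noteq> \<infinity>) \<and> (GDERIV (\<lambda>y. real_of_ereal (f y)) x :> v)}"


section \<open>Directionally Lipschitzian functions\<close>

definition locally_closed_at :: "'a::metric_space set \<Rightarrow> 'a \<Rightarrow> bool" where
  "locally_closed_at Q x \<longleftrightarrow> (\<exists>\<epsilon>>0. closed (Q \<inter> cball x \<epsilon>))"

definition locally_lsc_at :: "('a::metric_space \<Rightarrow> ereal) \<Rightarrow> 'a \<Rightarrow> bool" where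
  "locally_lsc_at f x \<longleftrightarrow> locally_closed_at (ereal_epigraph f) (x, real_of_ereal (f x))"

definition pointed :: "'a::real_vector set \<Rightarrow> bool" where
  "pointed K \<longleftrightarrow>
    (\<forall>(m::nat) v. (\<forall>i<m. v i \<in> K) \<and> (\<Sum>i<m. v i) = 0 \<longrightarrow> (\<forall>i<m. v i = 0))"

definition directionally_lipschitzian_at :: "('a::euclidean_space \<Rightarrow> ereal) \<Rightarrow> 'a \<Rightarrow> bool" where
  "directionally_lipschitzian_at f x \<longleftrightarrow>
    \<bar>f x\<bar> \<noteq> \<infinity> \<and> locally_lsc_at f x \<and> pointed (horizon_subdifferential f x)"


section \<open>Stratifiable functions\<close>

definition C2_on :: "('a::real_normed_vector \<Rightarrow> 'b::real_normed_vector) \<Rightarrow> 'a set \<Rightarrow> bool" where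
  "C2_on F U \<longleftrightarrow> open U \<and>
    (\<exists>(F1 :: 'a \<Rightarrow> 'a \<Rightarrow>\<^sub>L 'b) (F2 :: 'a \<Rightarrow> 'a \<Rightarrow>\<^sub>L ('a \<Rightarrow>\<^sub>L 'b)).
       (\<forall>x\<in>U. (F has_derivative blinfun_apply (F1 x)) (at x)) \<and>
       (\<forall>x\<in>U. (F1 has_derivative blinfun_apply (F2 x)) (at x)) \<and>
       continuous_on U F2)"

text \<open>
  An \<open>r\<close>-dimensional submanifold of an \<open>n\<close>-dimensional space is locally the zero set of a
  \<open>C\<^sup>2\<close> map into an \<open>(n - r)\<close>-dimensional space with surjective derivative. A linear
  subspace \<open>S\<close> of the ambient space serves as the \<open>(n - r)\<close>-dimensional target.
\<close>

definition C2_submanifold :: "nat \<Rightarrow> 'a::euclidean_space set \<Rightarrow> bool" where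
  "C2_submanifold r M \<longleftrightarrow>
    (\<forall>x\<in>M. \<exists>U (F :: 'a \<Rightarrow> 'a) F' S.
       x \<in> U \<and> C2_on F U \<and> subspace S \<and> dim S + r = DIM('a) \<and> F ` U \<subseteq> S \<and>
       M \<inter> U = {y \<in> U. F y = 0} \<and>
       (F has_derivative F') (at x) \<and> range F' = S)"

definition locally_finite_stratification :: "'a::euclidean_space set \<Rightarrow> 'a set set \<Rightarrow> bool" where
  "locally_finite_stratification Q \<M> \<longleftrightarrow>
    partition_on Q \<M> \<and>
    (\<forall>M\<in>\<M>. \<exists>r. C2_submanifold r M) \<and>
    (\<forall>M\<in>\<M>. \<exists>\<N>\<subseteq>\<M>. Q \<inter> closure M = \<Union>\<N>) \<and>
    (\<forall>x\<in>Q. \<exists>U. open U \<and> x \<in> U \<and> finite {M \<in> \<M>. M \<inter> U \<noteq> {}})"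

definition C2_smooth_on_stratum :: "('a::euclidean_space \<Rightarrow> ereal) \<Rightarrow> 'a set \<Rightarrow> bool" where
  "C2_smooth_on_stratum f M \<longleftrightarrow>
    (\<forall>x\<in>M. \<exists>U (g :: 'a \<Rightarrow> real).
       open U \<and> x \<in> U \<and> C2_on g UNIV \<and> (\<forall>y\<in>M \<inter> U. f y = ereal (g y)))"

definition stratifiable :: "('a::euclidean_space \<Rightarrow> ereal) \<Rightarrow> bool" where
  "stratifiable f \<longleftrightarrow>
    (\<exists>\<M>. locally_finite_stratification (effective_domain f) \<M> \<and>
         (\<forall>M\<in>\<M>. C2_smooth_on_stratum f M))"

end

theory Submission
  imports Defs
begin

text \<open>
  Write \<open>Q\<close> for the epigraph and \<open>z = (xbar, f xbar)\<close>. Pointedness gives a direction \<open>e\<close> with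
  \<open>e \<bullet> n < 0\<close> for all nonzero normals \<open>n\<close> of \<open>Q\<close> at \<open>z\<close>. Hence convex cones spanned by closed
  cones of normals are closed, and a vector outside of one is separated from it by some \<open>d\<close>
  that is strictly negative on the nonzero elements of the cone.

  For the inclusion from left to right take the cone spanned by the limits of multiples of
  \<open>(\<nabla>f(x), -1)\<close>, \<open>x \<in> \<Omega>\<close>, and by the normals of the domain, and suppose that \<open>(v, -1)\<close> is a Clarke
  normal outside of it. Then no ray in direction \<open>d\<close> from a point of \<open>Q\<close> near \<open>z\<close> leaves \<open>Q\<close>
  immediately, so \<open>d \<bullet> n \<le> 0\<close> for all normals \<open>n\<close> at \<open>z\<close>, contradicting \<open>d \<bullet> (v, -1) > 0\<close>. To see this,
  move the starting point into the interior of \<open>Q\<close> (along \<open>e\<close>) and choose the line so that it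
  misses the graph of \<open>f\<close> over the lower-dimensional strata; since that graph projects along \<open>d\<close>
  to a null set, almost every line does. Such a line can leave \<open>Q\<close> only at a smooth point of
  the graph, where \<open>d\<close> points into \<open>Q\<close>, or strictly above the graph, where continuity makes \<open>Q\<close>
  look like the product of the domain with a line.
\<close>

section \<open>Normal cones and separation\<close>

lemma frechet_normal_cone_point: "v \<in> frechet_normal_cone Q x \<Longrightarrow> x \<in> Q"
  by (simp add: frechet_normal_cone_def)

lemma zero_in_frechet_normal_cone: "x \<in> Q \<Longrightarrow> 0 \<in> frechet_normal_cone Q x"
  by (auto simp: frechet_normal_cone_def intro!: exI[of _ 1])

lemma frechet_normal_cone_scaleR:
  assumes v: "v \<in> frechet_normal_cone Q x" and "0 \<le> t"
  shows "t *\<^sub>R v \<in> frechet_normal_cone Q x"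
proof (cases "t = 0")
  case True
  then show ?thesis
    using zero_in_frechet_normal_cone[OF frechet_normal_cone_point[OF v]] by simp
next
  case False
  then have t: "t > 0" using \<open>0 \<le> t\<close> by simp
  have "\<exists>\<delta>>0. \<forall>y\<in>Q. norm (y - x) < \<delta> \<longrightarrow> t *\<^sub>R v \<bullet> (y - x) \<le> \<epsilon> * norm (y - x)"
    if "\<epsilon> > 0" for \<epsilon>
  proof -
    have "\<epsilon> / t > 0" using t that by simp
    then obtain \<delta> where "\<delta> > 0"
      and \<delta>: "\<And>y. y \<in> Q \<Longrightarrow> norm (y - x) < \<delta> \<Longrightarrow> v \<bullet> (y - x) \<le> \<epsilon> / t * norm (y - x)"
      using v unfolding frechet_normal_cone_def by blast
    have "t *\<^sub>R v \<bullet> (y - x) \<le> \<epsilon> * norm (y - x)" if "y \<in> Q" "norm (y - x) < \<delta>" for y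
      using mult_left_mono[OF \<delta>[OF that], of t] t by simp
    then show ?thesis using \<open>\<delta> > 0\<close> by blast
  qed
  then show ?thesis
    using frechet_normal_cone_point[OF v] by (simp add: frechet_normal_cone_def)
qed

text \<open>On the ray the defining estimate reads s (d \<bullet> v) \<le> \<epsilon> s |d|;
  dividing by s and taking \<epsilon> to be half of (d \<bullet> v) / |d| rules out a positive
  product.\<close>

lemma frechet_normal_nonpos_along_ray:
  assumes v: "v \<in> frechet_normal_cone Q x"
    and "\<eta> > 0" and ray: "\<And>s. 0 < s \<Longrightarrow> s \<le> \<eta> \<Longrightarrow> x + s *\<^sub>R d \<in> Q"
  shows "d \<bullet> v \<le> 0"
proof (rule ccontr)
  assume "\<not> d \<bullet> v \<le> 0"
  then have pos: "d \<bullet> v > 0" by simp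
  then have "d \<noteq> 0" by auto
  define \<epsilon> where "\<epsilon> = d \<bullet> v / (2 * norm d)"
  have "\<epsilon> > 0" using pos \<open>d \<noteq> 0\<close> by (simp add: \<epsilon>_def)
  then obtain \<delta> where "\<delta> > 0"
    and \<delta>: "\<And>y. y \<in> Q \<Longrightarrow> norm (y - x) < \<delta> \<Longrightarrow> v \<bullet> (y - x) \<le> \<epsilon> * norm (y - x)"
    using v unfolding frechet_normal_cone_def by blast
  define s where "s = min \<eta> (\<delta> / (2 * norm d))"
  have s: "0 < s" "s \<le> \<eta>" using \<open>\<eta> > 0\<close> \<open>\<delta> > 0\<close> \<open>d \<noteq> 0\<close> by (auto simp: s_def)
  have "s * norm d \<le> \<delta> / (2 * norm d) * norm d" by (rule mult_right_mono) (auto simp: s_def)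
  then have "s * norm d < \<delta>" using \<open>d \<noteq> 0\<close> \<open>\<delta> > 0\<close> by simp
  then have "v \<bullet> (s *\<^sub>R d) \<le> \<epsilon> * norm (s *\<^sub>R d)"
    using \<delta>[OF ray[OF s]] s by simp
  then have "s * (d \<bullet> v) \<le> s * (d \<bullet> v / 2)"
    using s \<open>d \<noteq> 0\<close> by (simp add: \<epsilon>_def inner_commute field_simps)
  then show False using s pos by simp
qed

section \<open>Limiting normals as limits of normals at nearby points\<close>

definition near_normals :: "'a::euclidean_space set \<Rightarrow> 'a \<Rightarrow> real \<Rightarrow> 'a set" where
  "near_normals Q x \<delta> = (\<Union>z\<in>Q \<inter> ball x \<delta>. frechet_normal_cone Q z)"

lemma near_normals_mono: "\<delta> \<le> \<delta>' \<Longrightarrow> near_normals Q x \<delta> \<subseteq> near_normals Q x \<delta>'"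
  unfolding near_normals_def by fastforce

lemma near_normals_scaleR: "v \<in> near_normals Q x \<delta> \<Longrightarrow> 0 \<le> t \<Longrightarrow> t *\<^sub>R v \<in> near_normals Q x \<delta>"
  unfolding near_normals_def using frechet_normal_cone_scaleR by blast

text \<open>Replaces sequences by an outer limit of a family that shrinks with \<delta>. Closedness
  and conicity then pass through the intersection, and compactness arguments apply to the whole
  family. The converse inclusion picks points and normals for the radii 1/(i+1).\<close>

lemma limiting_normal_cone_eq:
  assumes "x \<in> Q"
  shows "limiting_normal_cone Q x = (\<Inter>\<delta>\<in>{0<..}. closure (near_normals Q x \<delta>))"
proof (intro equalityI subsetI)
  fix v assume "v \<in> limiting_normal_cone Q x"
  then obtain X V where XV: "\<And>i. X i \<in> Q" "\<And>i. V i \<in> frechet_normal_cone Q (X i)"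
    and X: "X \<longlonglongrightarrow> x" and V: "V \<longlonglongrightarrow> v"
    unfolding limiting_normal_cone_def by blast
  have "v \<in> closure (near_normals Q x \<delta>)" if "\<delta> > 0" for \<delta>
  proof (rule Lim_in_closed_set[OF closed_closure _ _ V])
    have "\<forall>\<^sub>F i in sequentially. dist (X i) x < \<delta>" using X that by (rule tendstoD)
    then show "\<forall>\<^sub>F i in sequentially. V i \<in> closure (near_normals Q x \<delta>)"
    proof eventually_elim
      case (elim i)
      then have "V i \<in> near_normals Q x \<delta>"
        using XV[of i] by (auto simp: near_normals_def dist_commute)
      then show ?case using closure_subset by blast
    qed
  qed simp
  then show "v \<in> (\<Inter>\<delta>\<in>{0<..}. closure (near_normals Q x \<delta>))" by blast
next
  fix v assume v: "v \<in> (\<Inter>\<delta>\<in>{0<..}. closure (near_normals Q x \<delta>))"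
  define r where "r i = inverse (real (Suc i))" for i
  have "\<exists>z w. z \<in> Q \<and> w \<in> frechet_normal_cone Q z \<and> dist z x < r i \<and> dist w v < r i" for i
  proof -
    have "r i > 0" by (simp add: r_def)
    then obtain w where "w \<in> near_normals Q x (r i)" "dist w v < r i"
      using v by (force simp: closure_approachable)
    then show ?thesis unfolding near_normals_def by (metis IntE UN_E dist_commute mem_ball)
  qed
  then obtain X V where XV: "\<And>i. X i \<in> Q" "\<And>i. V i \<in> frechet_normal_cone Q (X i)"
      "\<And>i. dist (X i) x < r i" "\<And>i. dist (V i) v < r i"
    by metis
  have r: "r \<longlonglongrightarrow> 0" unfolding r_def by (rule LIMSEQ_inverse_real_of_nat)
  have "dist (X i) x \<le> dist (r i) 0" "dist (V i) v \<le> dist (r i) 0" for i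
    using XV(3,4)[of i] by (auto simp: r_def)
  then have "X \<longlonglongrightarrow> x" "V \<longlonglongrightarrow> v"
    by (auto intro: metric_tendsto_imp_tendsto[OF r] always_eventually)
  then show "v \<in> limiting_normal_cone Q x"
    using XV assms unfolding limiting_normal_cone_def by blast
qed

lemma closed_limiting_normal_cone: "closed (limiting_normal_cone Q x)"
proof (cases "x \<in> Q")
  case True
  then show ?thesis by (auto simp: limiting_normal_cone_eq)
next
  case False
  then show ?thesis by (simp add: limiting_normal_cone_def)
qed

section \<open>Conic sets and the convex cones they generate\<close>

lemma closure_scaleR_mem:
  fixes S :: "'a::real_normed_vector set"
  assumes "\<And>x. x \<in> S \<Longrightarrow> t *\<^sub>R x \<in> S" "a \<in> closure S"
  shows "t *\<^sub>R a \<in> closure S"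
proof -
  have "t *\<^sub>R a \<in> (*\<^sub>R) t ` closure S" using assms by blast
  also have "\<dots> = closure ((*\<^sub>R) t ` S)" by (simp add: closure_scaleR)
  also have "\<dots> \<subseteq> closure S" using assms by (intro closure_mono) auto
  finally show ?thesis .
qed

lemma conic_Inter_closure:
  fixes S :: "real \<Rightarrow> 'a::real_normed_vector set"
  assumes "\<And>\<delta> x t. x \<in> S \<delta> \<Longrightarrow> 0 \<le> t \<Longrightarrow> t *\<^sub>R x \<in> S \<delta>"
  shows "conic (\<Inter>\<delta>\<in>{0<..}. closure (S \<delta>))"
  unfolding conic_def using assms by (auto intro!: closure_scaleR_mem)

lemma conic_limiting_normal_cone: "conic (limiting_normal_cone Q x)"
proof (cases "x \<in> Q")
  case True
  then show ?thesis
    using conic_Inter_closure[of "near_normals Q x", OF near_normals_scaleR]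
    by (simp add: limiting_normal_cone_eq)
next
  case False
  then show ?thesis by (simp add: limiting_normal_cone_def conic_def)
qed

lemma frechet_subset_limiting_normal_cone: "frechet_normal_cone Q x \<subseteq> limiting_normal_cone Q x"
proof
  fix v assume v: "v \<in> frechet_normal_cone Q x"
  have "(\<lambda>_::nat. x) \<longlonglongrightarrow> x" "(\<lambda>_::nat. v) \<longlonglongrightarrow> v" by simp_all
  then show "v \<in> limiting_normal_cone Q x"
    unfolding limiting_normal_cone_def using v frechet_normal_cone_point[OF v]
    by (intro CollectI conjI exI[of _ "\<lambda>_. x"] exI[of _ "\<lambda>_. v"]) auto
qed

lemma zero_in_limiting_normal_cone: "x \<in> Q \<Longrightarrow> 0 \<in> limiting_normal_cone Q x"
  using frechet_subset_limiting_normal_cone zero_in_frechet_normal_cone by blast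

lemma conic_convex_hull:
  assumes "conic N"
  shows "conic (convex hull N)"
  unfolding conic_def
proof (intro allI impI)
  fix x and c :: real assume x: "x \<in> convex hull N" and "0 \<le> c"
  have "(*\<^sub>R) c ` N \<subseteq> N" using assms \<open>0 \<le> c\<close> by (auto simp: conic_def)
  then have "convex hull ((*\<^sub>R) c ` N) \<subseteq> convex hull N" by (rule hull_mono)
  then show "c *\<^sub>R x \<in> convex hull N" using x by (auto simp: convex_hull_scaling)
qed

lemma convex_cone_hull_conic:
  assumes "conic N" "N \<noteq> {}"
  shows "convex_cone hull N = convex hull N"
  using conic_convex_hull[OF assms(1)] assms
  by (simp add: convex_cone_hull_separate_nonempty conic_hull_eq)

lemma clarke_normal_cone_eq:
  "x \<in> Q \<Longrightarrow> clarke_normal_cone Q x = closure (convex_cone hull (limiting_normal_cone Q x))"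
  unfolding clarke_normal_cone_def
  by (subst convex_cone_hull_conic)
    (use zero_in_limiting_normal_cone[of x Q] in \<open>auto simp: conic_limiting_normal_cone\<close>)

text \<open>Compactness of the unit sphere: if no radius worked, unit vectors of
  \<open>S (r i)\<close> with \<open>d\<close>-product above \<open>- r i\<close> would accumulate
  at a unit vector of the outer limit with nonnegative product. The family is kept abstract because
  it is applied to nearby normals, to a constant family, and to cones over gradients.\<close>

lemma cone_gap:
  fixes S :: "real \<Rightarrow> 'a::euclidean_space set"
  assumes mono: "\<And>\<delta> \<delta>'. \<delta> \<le> \<delta>' \<Longrightarrow> S \<delta> \<subseteq> S \<delta>'"
    and scale: "\<And>\<delta> x t. x \<in> S \<delta> \<Longrightarrow> 0 \<le> t \<Longrightarrow> t *\<^sub>R x \<in> S \<delta>"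
    and neg: "\<And>a. a \<in> (\<Inter>\<delta>\<in>{0<..}. closure (S \<delta>)) \<Longrightarrow> a \<noteq> 0 \<Longrightarrow> d \<bullet> a < 0"
  obtains c \<delta> where "c > 0" "\<delta> > 0" "\<And>a. a \<in> S \<delta> \<Longrightarrow> d \<bullet> a \<le> - c * norm a"
proof -
  define r where "r i = inverse (real (Suc i))" for i
  have rpos: "r i > 0" for i by (simp add: r_def)
  have r: "r \<longlonglongrightarrow> 0" unfolding r_def by (rule LIMSEQ_inverse_real_of_nat)
  have "\<exists>i. \<forall>a\<in>S (r i). d \<bullet> a \<le> - r i * norm a"
  proof (rule ccontr)
    assume "\<not> ?thesis"
    then have "\<forall>i. \<exists>a. a \<in> S (r i) \<and> d \<bullet> a > - r i * norm a" by force
    then obtain a where a: "\<And>i. a i \<in> S (r i)" "\<And>i. d \<bullet> a i > - r i * norm (a i)" by metis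
    have nz: "a i \<noteq> 0" for i using a(2)[of i] by auto
    define b where "b i = (1 / norm (a i)) *\<^sub>R a i" for i
    have b: "b i \<in> S (r i)" "norm (b i) = 1" "d \<bullet> b i > - r i" for i
      using a[of i] nz[of i] scale[OF a(1), of "1 / norm (a i)" i]
      by (auto simp: b_def field_simps)
    have "\<forall>i. b i \<in> sphere 0 1" using b by simp
    then obtain l \<sigma> where l: "l \<in> sphere 0 1" "strict_mono \<sigma>" and lim: "(b \<circ> \<sigma>) \<longlonglongrightarrow> l"
      using compact_sphere[of 0 1] unfolding compact_def by blast
    have "l \<in> closure (S \<delta>)" if "\<delta> > 0" for \<delta>
    proof (rule Lim_in_closed_set[OF closed_closure _ _ lim])
      have "\<forall>\<^sub>F i in sequentially. (r \<circ> \<sigma>) i < \<delta>"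
        using LIMSEQ_subseq_LIMSEQ[OF r l(2)] that by (rule order_tendstoD)
      then show "\<forall>\<^sub>F i in sequentially. (b \<circ> \<sigma>) i \<in> closure (S \<delta>)"
      proof eventually_elim
        case (elim i)
        then show ?case
          using b(1)[of "\<sigma> i"] mono[of "r (\<sigma> i)" \<delta>] closure_subset[of "S \<delta>"] by auto
      qed
    qed simp
    moreover have "l \<noteq> 0" using l by auto
    ultimately have "d \<bullet> l < 0" using neg by blast
    moreover have "- 0 \<le> d \<bullet> l"
    proof (rule tendsto_le)
      show "((\<lambda>i. d \<bullet> (b \<circ> \<sigma>) i)) \<longlonglongrightarrow> d \<bullet> l" by (intro tendsto_intros lim)
      show "(\<lambda>i. - (r \<circ> \<sigma>) i) \<longlonglongrightarrow> - 0"
        by (intro tendsto_intros LIMSEQ_subseq_LIMSEQ[OF r l(2)])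
      show "\<forall>\<^sub>F i in sequentially. - (r \<circ> \<sigma>) i \<le> d \<bullet> (b \<circ> \<sigma>) i"
        using b(3) by (simp add: less_imp_le)
    qed simp
    ultimately show False by simp
  qed
  then show ?thesis using that rpos by blast
qed

lemma closed_conic_gap:
  fixes N :: "'a::euclidean_space set"
  assumes "closed N" "conic N" "\<And>n. n \<in> N \<Longrightarrow> n \<noteq> 0 \<Longrightarrow> d \<bullet> n < 0"
  obtains c where "c > 0" "\<And>n. n \<in> N \<Longrightarrow> d \<bullet> n \<le> - c * norm n"
proof (rule cone_gap[of "\<lambda>_. N" d])
  show "d \<bullet> a < 0" if "a \<in> (\<Inter>\<delta>\<in>{0::real<..}. closure N)" "a \<noteq> 0" for a
  proof (rule assms(3))
    show "a \<in> N" using that(1) assms(1) by (auto intro: gt_ex)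
  qed fact
qed (use assms in \<open>auto simp: conic_def\<close>)

lemma limiting_normal_cone_gap:
  assumes "x \<in> Q" "\<And>v. v \<in> limiting_normal_cone Q x \<Longrightarrow> v \<noteq> 0 \<Longrightarrow> d \<bullet> v < 0"
  obtains c \<delta> where "c > 0" "\<delta> > 0" "\<And>v. v \<in> near_normals Q x \<delta> \<Longrightarrow> d \<bullet> v \<le> - c * norm v"
proof (rule cone_gap[of "near_normals Q x" d])
  show "d \<bullet> a < 0" if "a \<in> (\<Inter>\<delta>\<in>{0<..}. closure (near_normals Q x \<delta>))" "a \<noteq> 0" for a
    using that assms(2) limiting_normal_cone_eq[OF assms(1)] by blast
next
  fix c \<delta> :: real
  assume "c > 0" "\<delta> > 0" "\<And>a. a \<in> near_normals Q x \<delta> \<Longrightarrow> d \<bullet> a \<le> - c * norm a"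
  then show ?thesis by (rule that)
qed (rule near_normals_mono near_normals_scaleR; assumption)+

text \<open>Pointedness prevents 0 from being a convex combination of unit vectors of N. Their
  convex hull is compact, so a hyperplane separates it strictly from 0; the separating functional is
  negated.\<close>

lemma pointed_imp_strict_direction:
  fixes N :: "'a::euclidean_space set"
  assumes "closed N" "conic N" "pointed N"
  obtains e where "\<And>n. n \<in> N \<Longrightarrow> n \<noteq> 0 \<Longrightarrow> e \<bullet> n < 0"
proof -
  define C where "C = N \<inter> sphere 0 1"
  have "compact C" unfolding C_def using assms(1) by (simp add: closed_Int_compact)
  then have cl: "closed (convex hull C)" using compact_convex_hull compact_imp_closed by blast
  have "0 \<notin> convex hull C"
  proof
    assume "0 \<in> convex hull C"
    then obtain S u where S: "finite S" "S \<subseteq> C" "\<forall>x\<in>S. 0 \<le> u x" "sum u S = 1"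
      and sum0: "(\<Sum>v\<in>S. u v *\<^sub>R v) = 0"
      unfolding convex_hull_explicit by blast
    \<comment> \<open>\<open>pointed\<close> speaks of families indexed by an initial segment, so
      the convex combination over S is reindexed.\<close>
    obtain h where h: "bij_betw h {..<card S} S"
      using ex_bij_betw_nat_finite[OF S(1)] by (auto simp: lessThan_atLeast0)
    let ?w = "\<lambda>i. u (h i) *\<^sub>R h i"
    have "(\<Sum>i<card S. ?w i) = 0"
      using sum.reindex_bij_betw[OF h, of "\<lambda>v. u v *\<^sub>R v"] sum0 by simp
    moreover have hS: "h i \<in> S" if "i < card S" for i
      using h that by (auto simp: bij_betw_def)
    then have "\<forall>i<card S. ?w i \<in> N"
      using S(2,3) assms(2) by (force simp: conic_def C_def)
    ultimately have z: "\<forall>i<card S. ?w i = 0" using assms(3) unfolding pointed_def by meson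
    have "u v = 0" if "v \<in> S" for v
    proof -
      have "v \<in> h ` {..<card S}" using h that by (simp add: bij_betw_def)
      then obtain i where "i < card S" "v = h i" by blast
      then have "u v *\<^sub>R v = 0" using z by blast
      moreover have "v \<noteq> 0" using that S(2) by (auto simp: C_def)
      ultimately show ?thesis by simp
    qed
    then show False using S(4) by simp
  qed
  then obtain a b where ab: "b > 0" "\<And>x. x \<in> convex hull C \<Longrightarrow> a \<bullet> x > b"
    using separating_hyperplane_closed_0[OF convex_convex_hull cl] by blast
  show ?thesis
  proof
    fix n assume n: "n \<in> N" "n \<noteq> 0"
    then have "(1 / norm n) *\<^sub>R n \<in> C" using assms(2) by (auto simp: C_def conic_def)
    then have "a \<bullet> ((1 / norm n) *\<^sub>R n) > 0" using ab hull_inc by fastforce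
    then show "(- a) \<bullet> n < 0" using n by (simp add: zero_less_divide_iff)
  qed
qed

text \<open>The functional e keeps the convex hull of the unit vectors of N away from 0, which makes
  the generated cone closed. Ordinary separation from v gives a functional that is only nonpositive
  on N; adding a small multiple of e makes it strict.\<close>

lemma convex_cone_hull_separation:
  fixes N :: "'a::euclidean_space set"
  assumes "closed N" "conic N" and e: "\<And>n. n \<in> N \<Longrightarrow> n \<noteq> 0 \<Longrightarrow> e \<bullet> n < 0"
    and v: "v \<notin> convex_cone hull N"
  obtains d where "\<And>n. n \<in> N \<Longrightarrow> n \<noteq> 0 \<Longrightarrow> d \<bullet> n < 0" "d \<bullet> v > 0"
proof -
  define C where "C = N \<inter> sphere 0 1"
  have "compact C" unfolding C_def using assms(1) by (simp add: closed_Int_compact)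
  have N_C: "n \<in> convex_cone hull C" if "n \<in> N" for n
  proof (cases "n = 0")
    case False
    then have "(1 / norm n) *\<^sub>R n \<in> C" using assms(2) that by (auto simp: C_def conic_def)
    then have "norm n *\<^sub>R ((1 / norm n) *\<^sub>R n) \<in> convex_cone hull C"
      by (intro convex_cone_hull_mul hull_inc) auto
    then show ?thesis using False by simp
  qed (simp add: convex_cone_hull_contains_0)
  have "convex_cone hull N \<subseteq> convex_cone hull C"
    by (rule hull_minimal) (use N_C convex_cone_convex_cone_hull in auto)
  moreover have CN: "convex_cone hull C \<subseteq> convex_cone hull N"
    by (rule hull_mono) (auto simp: C_def)
  ultimately have eq: "convex_cone hull N = convex_cone hull C" by blast
  have "convex hull C \<subseteq> {x. e \<bullet> x < 0}"
    by (rule hull_minimal) (auto simp: C_def convex_halfspace_lt intro: e)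
  then have "0 \<notin> convex hull C" by auto
  then have "closed (conic hull (convex hull C))"
    using closed_conic_hull compact_convex_hull[OF \<open>compact C\<close>] by blast
  then have "closed (convex_cone hull N)"
    unfolding eq convex_cone_hull_separate[of C] by (rule closed_insert)
  then obtain a b where ab: "a \<bullet> v < b" "\<And>x. x \<in> convex_cone hull N \<Longrightarrow> a \<bullet> x > b"
    using separating_hyperplane_closed_point[OF convex_convex_cone_hull _ v] by blast
  have "b < 0" using ab(2)[OF convex_cone_hull_contains_0] by simp
  have nonneg: "a \<bullet> n \<ge> 0" if "n \<in> N" for n
  proof (rule ccontr)
    assume neg: "\<not> a \<bullet> n \<ge> 0"
    \<comment> \<open>A nonnegative multiple of n on which a takes exactly the value b, which the
      strict bound on the cone forbids.\<close>
    then have "(b / (a \<bullet> n)) *\<^sub>R n \<in> convex_cone hull N"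
      using that \<open>b < 0\<close> by (intro convex_cone_hull_mul hull_inc) (auto intro: divide_nonpos_nonpos)
    from ab(2)[OF this] show False using neg by simp
  qed
  have "a \<bullet> v < 0" using ab \<open>b < 0\<close> by simp
  \<comment> \<open>Small enough that \<tau> e changes the value at v by at most half of - (a
    \<bullet> v).\<close>
  define \<tau> where "\<tau> = - (a \<bullet> v) / (2 * (\<bar>e \<bullet> v\<bar> + 1))"
  have "\<tau> > 0" using \<open>a \<bullet> v < 0\<close> unfolding \<tau>_def by (intro divide_pos_pos) auto
  show ?thesis
  proof
    show "(\<tau> *\<^sub>R e - a) \<bullet> n < 0" if "n \<in> N" "n \<noteq> 0" for n
      using mult_strict_left_mono[OF e[OF that] \<open>\<tau> > 0\<close>] nonneg[OF that(1)]
      by (simp add: inner_diff_left)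
    have "\<tau> * \<bar>e \<bullet> v\<bar> \<le> \<tau> * (\<bar>e \<bullet> v\<bar> + 1)" using \<open>\<tau> > 0\<close> by simp
    also have "\<dots> = - (a \<bullet> v) / 2" unfolding \<tau>_def by (simp add: field_simps)
    finally have "\<tau> * \<bar>e \<bullet> v\<bar> < - (a \<bullet> v)" using \<open>a \<bullet> v < 0\<close> by simp
    moreover have "- (\<tau> * \<bar>e \<bullet> v\<bar>) \<le> \<tau> * (e \<bullet> v)"
      using \<open>\<tau> > 0\<close> by (simp add: abs_if)
    ultimately show "(\<tau> *\<^sub>R e - a) \<bullet> v > 0" by (simp add: inner_diff_left)
  qed
qed

section \<open>Rays in closed sets and null sets of lines\<close>

text \<open>Expanding |w - p|^2 \<le> |w - y|^2 bounds 2 (w - p) \<bullet> (y - p) by |y - p|^2,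
  which is of second order.\<close>

lemma proximal_imp_frechet_normal:
  fixes Q :: "'a::euclidean_space set"
  assumes "p \<in> Q" "\<rho> > 0"
    and near: "\<And>y. y \<in> Q \<Longrightarrow> dist y p < \<rho> \<Longrightarrow> dist w p \<le> dist w y"
  shows "w - p \<in> frechet_normal_cone Q p"
proof -
  have "\<exists>\<delta>>0. \<forall>y\<in>Q. norm (y - p) < \<delta> \<longrightarrow> (w - p) \<bullet> (y - p) \<le> \<epsilon> * norm (y - p)"
    if "\<epsilon> > 0" for \<epsilon>
  proof (intro exI conjI ballI impI)
    show "min \<rho> (2 * \<epsilon>) > 0" using assms that by simp
    fix y assume y: "y \<in> Q" "norm (y - p) < min \<rho> (2 * \<epsilon>)"
    then have "norm (w - p) \<le> norm (w - y)" using near by (simp add: dist_norm)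
    then have "(norm (w - p))\<^sup>2 \<le> (norm (w - y))\<^sup>2" by simp
    also have "w - y = (w - p) - (y - p)" by simp
    also have "(norm ((w - p) - (y - p)))\<^sup>2 =
        (norm (w - p))\<^sup>2 - 2 * ((w - p) \<bullet> (y - p)) + (norm (y - p))\<^sup>2"
      unfolding power2_norm_eq_inner by (simp add: inner_diff inner_commute)
    finally have "2 * ((w - p) \<bullet> (y - p)) \<le> norm (y - p) * norm (y - p)"
      by (simp add: power2_eq_square)
    also have "\<dots> \<le> (2 * \<epsilon>) * norm (y - p)" using y by (intro mult_right_mono) auto
    finally show "(w - p) \<bullet> (y - p) \<le> \<epsilon> * norm (y - p)" by simp
  qed
  then show ?thesis using \<open>p \<in> Q\<close> by (simp add: frechet_normal_cone_def)
qed

text \<open>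
  The squared distance to \<open>Q\<close> along the ray cannot leave \<open>0\<close>: at a point \<open>w\<close> with nearest
  point \<open>p\<close> its upper right derivative is at most \<open>2 (d \<bullet> (w - p))\<close>, and \<open>w - p\<close> is a
  normal.
\<close>

lemma ray_stays_in_set:
  fixes Q :: "'a::euclidean_space set"
  assumes cl: "closed (Q \<inter> cball z \<epsilon>)"
    and normals: "\<And>v. v \<in> near_normals Q z \<epsilon> \<Longrightarrow> d \<bullet> v \<le> 0"
    and "z' \<in> Q" "0 \<le> s" and bound: "dist z z' + 2 * (s * norm d) < \<epsilon>"
  shows "z' + s *\<^sub>R d \<in> Q"
proof -
  define C where "C = Q \<inter> cball z \<epsilon>"
  have "s * norm d \<ge> 0" using \<open>0 \<le> s\<close> by simp
  then have "dist z z' < \<epsilon>" using bound by linarith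
  then have z'C: "z' \<in> C" using \<open>z' \<in> Q\<close> by (simp add: C_def)
  define w where "w t = z' + t *\<^sub>R d" for t
  define \<phi> where "\<phi> t = (infdist (w t) C)\<^sup>2" for t
  have w_z': "dist (w t) z' = t * norm d" if "0 \<le> t" for t
    using that by (simp add: w_def dist_norm)
  have cont: "continuous_on A \<phi>" for A
    unfolding \<phi>_def w_def by (intro continuous_intros)
  have inf_le: "infdist (w t) C \<le> t * norm d" if "0 \<le> t" for t
    using infdist_le[OF z'C, of "w t"] w_z'[OF that] by simp
  \<comment> \<open>The squared distance to the fixed point p nearest to \<open>w t\<close> is a
    quadratic in t' that lies above \<phi> and agrees with it at t.\<close>
  have slope: "\<exists>m\<le>0. \<forall>t'. \<phi> t' \<le> \<phi> t + 2 * (t' - t) * m + (t' - t)\<^sup>2 * (norm d)\<^sup>2"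
    if t: "0 \<le> t" "t \<le> s" for t
  proof -
    have "closed C" "C \<noteq> {}" using cl z'C by (auto simp: C_def)
    then obtain p where "p \<in> C" and inf_p: "infdist (w t) C = dist (w t) p"
      using infdist_attains_inf by blast
    then have p: "p \<in> C" "\<And>y. y \<in> C \<Longrightarrow> dist (w t) p \<le> dist (w t) y"
      using infdist_le[of _ C "w t"] by simp_all
    have "t * norm d \<le> s * norm d" using t by (simp add: mult_right_mono)
    \<comment> \<open>Since z' itself belongs to C, p is no farther from \<open>w t\<close> than t
      |d|. This second length is the reason for the factor 2 in the bound, and it places p inside
      the open ball, where truncating Q is harmless.\<close>
    have "dist z p \<le> dist z z' + dist z' (w t) + dist (w t) p"
      by (meson add_right_mono dist_triangle dist_triangle2 order_trans)
    also have "\<dots> \<le> dist z z' + t * norm d + t * norm d"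
      using w_z'[OF t(1)] p(2)[OF z'C] by (simp add: dist_commute)
    finally have "dist z p < \<epsilon>" using bound \<open>t * norm d \<le> s * norm d\<close> by linarith
    have "w t - p \<in> frechet_normal_cone Q p"
    proof (rule proximal_imp_frechet_normal)
      show "p \<in> Q" using p by (simp add: C_def)
      show "\<epsilon> - dist z p > 0" using \<open>dist z p < \<epsilon>\<close> by simp
      fix y assume "y \<in> Q" "dist y p < \<epsilon> - dist z p"
      moreover have "dist z y \<le> dist z p + dist y p" by (simp add: dist_triangle2)
      ultimately have "y \<in> C" by (simp add: C_def)
      then show "dist (w t) p \<le> dist (w t) y" by (rule p)
    qed
    then have "w t - p \<in> near_normals Q z \<epsilon>"
      using p \<open>dist z p < \<epsilon>\<close> by (auto simp: near_normals_def C_def)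
    then have "d \<bullet> (w t - p) \<le> 0" by (rule normals)
    moreover have "\<phi> t' \<le> \<phi> t + 2 * (t' - t) * (d \<bullet> (w t - p)) + (t' - t)\<^sup>2 * (norm d)\<^sup>2" for t'
    proof -
      have "infdist (w t') C \<le> dist (w t') p" using p by (intro infdist_le)
      then have "\<phi> t' \<le> (norm (w t' - p))\<^sup>2"
        unfolding \<phi>_def dist_norm by (intro power_mono infdist_nonneg)
      also have "w t' - p = (w t - p) + (t' - t) *\<^sub>R d" by (simp add: w_def algebra_simps)
      also have "(norm ((w t - p) + (t' - t) *\<^sub>R d))\<^sup>2 =
          (norm (w t - p))\<^sup>2 + 2 * (t' - t) * (d \<bullet> (w t - p)) + (t' - t)\<^sup>2 * (norm d)\<^sup>2"
        unfolding power2_norm_eq_inner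
        by (simp add: inner_add inner_commute power2_eq_square)
      finally show ?thesis by (simp add: \<phi>_def inf_p dist_norm)
    qed
    ultimately show ?thesis by blast
  qed
  have "\<phi> s = 0"
  proof (rule ccontr)
    assume "\<phi> s \<noteq> 0"
    then have pos: "\<phi> s > 0" by (simp add: \<phi>_def)
    have \<phi>0: "\<phi> 0 = 0" using z'C by (simp add: \<phi>_def w_def)
    have "s > 0" using pos \<phi>0 \<open>0 \<le> s\<close> by (cases "s = 0") auto
    \<comment> \<open>Half the average slope of \<phi> on [0, s]. The line of slope \<eta> starts at
      \<phi> 0 and ends below \<phi> s, so there is a last time t with \<phi> on or below it; the
      quadratic bound at t extends this beyond t.\<close>
    define \<eta> where "\<eta> = \<phi> s / (2 * s)"
    have "\<eta> > 0" using pos \<open>s > 0\<close> by (simp add: \<eta>_def)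
    have \<eta>s: "\<eta> * s < \<phi> s" using pos \<open>s > 0\<close> by (simp add: \<eta>_def)
    define T where "T = {t \<in> {0..s}. \<phi> t \<le> \<eta> * t}"
    have "closed {t \<in> {0..s}. \<phi> t \<le> \<eta> * t}"
      by (rule continuous_on_closed_Collect_le) (auto intro!: continuous_intros cont)
    then have "compact T"
      using closed_Int_compact[OF _ compact_Icc, of T 0 s] by (simp add: T_def Int_def conj_ac)
    moreover have "0 \<in> T" using \<open>0 \<le> s\<close> \<phi>0 by (simp add: T_def)
    ultimately obtain t where "t \<in> T" and tmax: "\<And>t'. t' \<in> T \<Longrightarrow> t' \<le> t"
      using compact_attains_sup[of T] by blast
    then have t: "0 \<le> t" "t \<le> s" "\<phi> t \<le> \<eta> * t" by (auto simp: T_def)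
    have "t < s" using t \<eta>s by (cases "t = s") auto
    obtain m where "m \<le> 0"
      and m: "\<And>t'. \<phi> t' \<le> \<phi> t + 2 * (t' - t) * m + (t' - t)\<^sup>2 * (norm d)\<^sup>2"
      using slope t by blast
    \<comment> \<open>The second bound makes the quadratic term h^2 |d|^2 at most \<eta> h.\<close>
    define h where "h = min (s - t) (\<eta> / ((norm d)\<^sup>2 + 1))"
    have "h > 0" using \<open>t < s\<close> \<open>\<eta> > 0\<close> by (auto simp: h_def intro!: divide_pos_pos add_nonneg_pos)
    have "t + h \<notin> T" using tmax[of "t + h"] \<open>h > 0\<close> by auto
    then have "\<phi> (t + h) > \<eta> * (t + h)" using t \<open>h > 0\<close> by (auto simp: T_def h_def)
    moreover have "\<phi> (t + h) \<le> \<eta> * (t + h)"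
    proof -
      have "h * (norm d)\<^sup>2 \<le> h * ((norm d)\<^sup>2 + 1)" using \<open>h > 0\<close> by simp
      also have "\<dots> \<le> \<eta> / ((norm d)\<^sup>2 + 1) * ((norm d)\<^sup>2 + 1)"
        by (intro mult_right_mono) (auto simp: h_def)
      also have "\<dots> = \<eta>"
        by (simp add: add_nonneg_eq_0_iff)
      finally have "h * (h * (norm d)\<^sup>2) \<le> h * \<eta>" using \<open>h > 0\<close> by simp
      moreover have "2 * h * m \<le> 0" using \<open>h > 0\<close> \<open>m \<le> 0\<close> by (simp add: mult_nonneg_nonpos)
      ultimately show ?thesis
        using m[of "t + h"] t(3) by (simp add: power2_eq_square algebra_simps)
    qed
    ultimately show False by simp
  qed
  then have "infdist (w s) C = 0" by (simp add: \<phi>_def)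
  moreover have "closed C" "C \<noteq> {}" using cl z'C by (auto simp: C_def)
  ultimately have "w s \<in> C" using in_closed_iff_infdist_zero by blast
  then show ?thesis by (simp add: C_def w_def)
qed

text \<open>A single component of F with nonzero derivative suffices: once it is used as a
  coordinate, the zero set lies in the differentiable image of a piece of a hyperplane.\<close>

lemma negligible_levelset:
  fixes F :: "'a::euclidean_space \<Rightarrow> 'a"
  assumes F: "C2_on F U" and "x \<in> U" "F x = 0"
    and F': "(F has_derivative F') (at x)" "range F' \<noteq> {0}"
  obtains W where "open W" "x \<in> W" "negligible {y \<in> W. F y = 0}"
proof -
  obtain F1 F2 where "open U" and F1: "\<And>x. x \<in> U \<Longrightarrow> (F has_derivative blinfun_apply (F1 x)) (at x)"
    and F2: "\<And>x. x \<in> U \<Longrightarrow> (F1 has_derivative blinfun_apply (F2 x)) (at x)"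
    using F unfolding C2_on_def by blast
  have F'_eq: "F' = blinfun_apply (F1 x)"
    using F1[OF \<open>x \<in> U\<close>] F'(1) has_derivative_unique by blast
  then obtain a where a: "F1 x a \<noteq> 0"
    using F'(2) by fastforce
  then have "a \<noteq> 0" by auto
  define b where "b = F1 x a"
  define a' where "a' = (1 / (a \<bullet> a)) *\<^sub>R a"
  have a'a: "a' \<bullet> a = 1" using \<open>a \<noteq> 0\<close> by (simp add: a'_def)
  \<comment> \<open>\<open>G\<close> replaces the coordinate along \<open>a\<close> by a component of \<open>F\<close> that increases along \<open>a\<close>,
    hence straightens the level set into a hyperplane.\<close>
  define G where "G y = y + (b \<bullet> F y - a' \<bullet> y) *\<^sub>R a" for y
  define G1 where "G1 y = id_blinfun + (blinfun_scaleR_left a o\<^sub>L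
      ((blinfun_inner_right b o\<^sub>L F1 y) - blinfun_inner_right a'))" for y
  have G1_apply: "G1 y h = h + (b \<bullet> F1 y h - a' \<bullet> h) *\<^sub>R a" for y h
    by (simp add: G1_def blinfun.bilinear_simps)
  have "linear (blinfun_apply (G1 x))"
    by (simp add: blinfun.bounded_linear_right bounded_linear.linear)
  moreover have "inj (blinfun_apply (G1 x))"
  proof (rule linear_injective_0[OF \<open>linear (blinfun_apply (G1 x))\<close>, THEN iffD2], intro allI impI)
    fix h assume "G1 x h = 0"
    then have h: "h = (a' \<bullet> h - b \<bullet> F1 x h) *\<^sub>R a"
      by (simp add: G1_apply algebra_simps add_eq_0_iff)
    define k where "k = a' \<bullet> h - b \<bullet> F1 x h"
    have hk: "h = k *\<^sub>R a" using h by (simp add: k_def)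
    \<comment> \<open>Insert h = k a into the definition of k, using that \<open>F1 x\<close> sends
      a to b and that a' \<bullet> a = 1.\<close>
    have "k = k - k * (b \<bullet> b)"
      using k_def unfolding hk by (simp add: blinfun.bilinear_simps a'a b_def)
    then have "k = 0" using a by (simp add: b_def)
    then show "h = 0" using hk by simp
  qed
  ultimately obtain g0 where g0: "linear g0" "g0 \<circ> blinfun_apply (G1 x) = id"
    using linear_injective_left_inverse by blast
  define J where "J = Blinfun g0"
  have J: "J o\<^sub>L G1 x = id_blinfun"
    using g0 by (intro blinfun_eqI)
      (simp add: J_def bounded_linear_Blinfun_apply linear_conv_bounded_linear[symmetric] fun_eq_iff)
  have derG: "(G has_derivative blinfun_apply (G1 y)) (at y)" if "y \<in> U" for y
    unfolding G_def
    by (rule has_derivative_eq_rhs, (rule derivative_intros F1[OF that])+)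
      (simp add: G1_apply fun_eq_iff)
  have "continuous_on U F1"
    using F2 by (meson continuous_at_imp_continuous_on has_derivative_continuous)
  then have "continuous_on U G1"
    unfolding G1_def
    by (intro continuous_intros bounded_bilinear.continuous_on[OF bounded_bilinear_blinfun_compose])
  show ?thesis
  proof (rule inverse_function_theorem[OF \<open>open U\<close> _ \<open>continuous_on U G1\<close> \<open>x \<in> U\<close> J])
    show "(G has_derivative blinfun_apply (G1 y)) (at y)" if "y \<in> U" for y
      by (rule derG[OF that])
  next
    fix W V g and g' :: "'a \<Rightarrow> 'a \<Rightarrow> 'a"
    assume "open W" "x \<in> W" and hom: "homeomorphism W V G g"
      and derg: "\<And>y. y \<in> V \<Longrightarrow> (g has_derivative g' y) (at y)"
    have "{y \<in> W. F y = 0} \<subseteq> g ` ({y. a' \<bullet> y = 0} \<inter> V)"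
    proof
      fix y assume y: "y \<in> {y \<in> W. F y = 0}"
      then have "G y \<in> V" "g (G y) = y"
        using hom by (auto simp: homeomorphism_def)
      moreover have "a' \<bullet> G y = 0" using y by (simp add: G_def inner_diff_right inner_scaleR_right a'a)
      ultimately show "y \<in> g ` ({y. a' \<bullet> y = 0} \<inter> V)"
        by (metis (mono_tags, lifting) IntI image_eqI mem_Collect_eq)
    qed
    moreover have "negligible (g ` ({y. a' \<bullet> y = 0} \<inter> V))"
    proof (rule negligible_differentiable_image_negligible)
      have "a' \<noteq> 0" using a'a by auto
      then show "negligible ({y. a' \<bullet> y = 0} \<inter> V)"
        using negligible_hyperplane[of a' 0] by (auto intro: negligible_subset)
      show "g differentiable_on {y. a' \<bullet> y = 0} \<inter> V"
        unfolding differentiable_on_def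
      proof
        fix y assume "y \<in> {y. a' \<bullet> y = 0} \<inter> V"
        then have "(g has_derivative g' y) (at y)" by (intro derg) simp
        then show "g differentiable (at y within {y. a' \<bullet> y = 0} \<inter> V)"
          by (rule differentiableI[OF has_derivative_at_withinI])
      qed
    qed simp
    ultimately have "negligible {y \<in> W. F y = 0}" by (rule negligible_subset[rotated])
    then show ?thesis using that \<open>open W\<close> \<open>x \<in> W\<close> by blast
  qed
qed

section \<open>Strata are null or open\<close>

lemma negligible_C2_submanifold:
  fixes M :: "'a::euclidean_space set"
  assumes "C2_submanifold r M" "r \<noteq> DIM('a)"
  shows "negligible M"
proof (subst locally_negligible_alt, rule ballI)
  fix x assume "x \<in> M"
  from assms(1)[unfolded C2_submanifold_def, rule_format, OF \<open>x \<in> M\<close>]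
  obtain U and F :: "'a \<Rightarrow> 'a" and F' S
    where U: "x \<in> U" "C2_on F U" "M \<inter> U = {y \<in> U. F y = 0}"
    and S: "dim S + r = DIM('a)" and F': "(F has_derivative F') (at x)" "range F' = S"
    by blast
  have "open U" using U(2) by (simp add: C2_on_def)
  \<comment> \<open>The codimension \<open>dim S\<close> is positive because r differs from the
    dimension of the space.\<close>
  have "range F' \<noteq> {0}" using F'(2) S assms(2) by auto
  then obtain W where W: "open W" "x \<in> W" "negligible {y \<in> W. F y = 0}"
    using negligible_levelset[OF U(2,1) _ F'(1)] U \<open>x \<in> M\<close> by blast
  have "negligible (M \<inter> (U \<inter> W))"
    by (rule negligible_subset[OF W(3)]) (use U(3) in blast)
  then show "\<exists>V. openin (top_of_set M) V \<and> x \<in> V \<and> negligible V"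
    using \<open>x \<in> M\<close> U(1) W \<open>open U\<close> by (intro exI[of _ "M \<inter> (U \<inter> W)"]) auto
qed

text \<open>Codimension zero forces S = {0}, so the local equation F = 0 holds on all of U.\<close>

lemma open_C2_submanifold:
  fixes M :: "'a::euclidean_space set"
  assumes "C2_submanifold (DIM('a)) M"
  shows "open M"
  proof (subst open_subopen, rule ballI)
  fix x assume "x \<in> M"
  from assms(1)[unfolded C2_submanifold_def, rule_format, OF \<open>x \<in> M\<close>]
  obtain U and F :: "'a \<Rightarrow> 'a" and S where U: "x \<in> U" "C2_on F U" "M \<inter> U = {y \<in> U. F y = 0}"
    and S: "dim S + DIM('a) = DIM('a)" "F ` U \<subseteq> S"
    by blast
  have "U \<subseteq> M" using U(3) S by auto
  then show "\<exists>T. open T \<and> x \<in> T \<and> T \<subseteq> M" using U by (auto simp: C2_on_def)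
qed

text \<open>The map projects the graph point (x, f x) along (d, 1) onto the hyperplane at height 0.
  It is a differentiable map between spaces of equal dimension, so it sends the null set M to a null
  set.\<close>

lemma negligible_sheared_graph:
  fixes d :: "'a::euclidean_space"
  assumes f: "C2_smooth_on_stratum f M" and "negligible M"
  shows "negligible ((\<lambda>x. x - real_of_ereal (f x) *\<^sub>R d) ` M)"
proof (rule negligible_differentiable_image_negligible)
  show "(\<lambda>x. x - real_of_ereal (f x) *\<^sub>R d) differentiable_on M"
    unfolding differentiable_on_def
  proof
    fix x assume "x \<in> M"
    with f have "\<exists>U (g :: 'a \<Rightarrow> real).
        open U \<and> x \<in> U \<and> C2_on g UNIV \<and> (\<forall>y\<in>M \<inter> U. f y = ereal (g y))"
      by (simp only: C2_smooth_on_stratum_def)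
    then obtain U and g :: "'a \<Rightarrow> real" where U: "open U" "x \<in> U" and g: "C2_on g UNIV"
      and fg: "\<forall>y\<in>M \<inter> U. f y = ereal (g y)"
      by (elim exE conjE)
    obtain g1 where "\<And>y. (g has_derivative blinfun_apply (g1 y)) (at y)"
      using g unfolding C2_on_def by blast
    then have "(g has_derivative blinfun_apply (g1 x)) (at x within M)"
      by (rule has_derivative_at_withinI)
    then have der: "((\<lambda>x. x - g x *\<^sub>R d) has_derivative (\<lambda>h. h - g1 x h *\<^sub>R d)) (at x within M)"
      by (rule has_derivative_diff[OF has_derivative_ident has_derivative_scaleR_left])
    obtain e where "e > 0" "ball x e \<subseteq> U" using U open_contains_ball by blast
    \<comment> \<open>f agrees with g only on the stratum, hence derivatives within M.\<close>
    have "((\<lambda>x. x - real_of_ereal (f x) *\<^sub>R d) has_derivative (\<lambda>h. h - g1 x h *\<^sub>R d))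
        (at x within M)"
    proof (rule has_derivative_transform_within[OF der \<open>e > 0\<close> \<open>x \<in> M\<close>])
      fix y assume "y \<in> M" "dist y x < e"
      then show "y - g y *\<^sub>R d = y - real_of_ereal (f y) *\<^sub>R d"
        using \<open>ball x e \<subseteq> U\<close> fg by (auto simp: dist_commute)
    qed
    then show "(\<lambda>x. x - real_of_ereal (f x) *\<^sub>R d) differentiable (at x within M)"
      by (rule differentiableI)
  qed
qed (use assms in auto)

section \<open>Normals and rays of epigraphs\<close>

text \<open>Splitting an extended-valued function into its domain and a real-valued part allows
  continuity and derivatives to be stated for real functions.\<close>

definition real_epigraph :: "'a set \<Rightarrow> ('a \<Rightarrow> real) \<Rightarrow> ('a \<times> real) set" where
  "real_epigraph D \<phi> = {(x, r). x \<in> D \<and> \<phi> x \<le> r}"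

lemma mem_real_epigraph [simp]: "(x, r) \<in> real_epigraph D \<phi> \<longleftrightarrow> x \<in> D \<and> \<phi> x \<le> r"
  by (simp add: real_epigraph_def)

section \<open>Normals of epigraphs\<close>

lemma epigraph_normal_snd_nonpos:
  assumes v: "v \<in> frechet_normal_cone (real_epigraph D \<phi>) z"
  shows "snd v \<le> 0"
proof -
  have "(0, 1) \<bullet> v \<le> 0"
  proof (rule frechet_normal_nonpos_along_ray[OF v zero_less_one])
    fix s :: real assume "0 < s"
    then show "z + s *\<^sub>R (0, 1) \<in> real_epigraph D \<phi>"
      using frechet_normal_cone_point[OF v] by (cases z) auto
  qed
  then show ?thesis by (cases v) simp
qed

lemma epigraph_limiting_normal_snd_nonpos:
  assumes "n \<in> limiting_normal_cone (real_epigraph D \<phi>) z"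
  shows "snd n \<le> 0"
proof -
  obtain V where "\<And>i. snd (V i) \<le> 0" "V \<longlonglongrightarrow> n"
    using assms epigraph_normal_snd_nonpos unfolding limiting_normal_cone_def by blast
  then show ?thesis
    by (intro tendsto_upperbound[of "\<lambda>i. snd (V i)" _ sequentially] tendsto_snd) auto
qed

text \<open>The last components of normals all have the same sign, so a vanishing sum makes each of
  them vanish and only horizontal normals remain.\<close>

lemma pointed_epigraph_limiting_normal_cone:
  fixes D :: "'a::euclidean_space set"
  assumes "pointed {v. (v, 0) \<in> limiting_normal_cone (real_epigraph D \<phi>) z}"
  shows "pointed (limiting_normal_cone (real_epigraph D \<phi>) z)"
  unfolding pointed_def
proof (intro allI impI, elim conjE)
  fix m :: nat and n i
  assume n: "\<forall>i<m. n i \<in> limiting_normal_cone (real_epigraph D \<phi>) z"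
    and sum0: "(\<Sum>i<m. n i) = 0" and i: "i < m"
  have "(\<Sum>i<m. - snd (n i)) = 0" using sum0 by (simp add: sum_negf flip: snd_sum)
  moreover have "- snd (n i) \<ge> 0" if "i < m" for i
    using epigraph_limiting_normal_snd_nonpos n that by fastforce
  ultimately have snd0: "\<forall>i<m. snd (n i) = 0"
    by (subst (asm) sum_nonneg_eq_0_iff) auto
  have "\<forall>i<m. fst (n i) \<in> {v. (v, 0) \<in> limiting_normal_cone (real_epigraph D \<phi>) z}"
  proof (intro allI impI)
    fix i assume "i < m"
    then have "n i = (fst (n i), 0)" using snd0 by (simp add: prod_eq_iff)
    then show "fst (n i) \<in> {v. (v, 0) \<in> limiting_normal_cone (real_epigraph D \<phi>) z}"
      using n \<open>i < m\<close> by (metis mem_Collect_eq)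
  qed
  moreover have "(\<Sum>i<m. fst (n i)) = 0" using sum0 by (simp flip: fst_sum)
  ultimately have "\<forall>i<m. fst (n i) = 0"
    by (intro assms[unfolded pointed_def, THEN spec, THEN spec, of m "\<lambda>i. fst (n i)", THEN mp] conjI)
  then show "n i = 0" using snd0 i by (simp add: prod_eq_iff)
qed

text \<open>Projecting to the domain does not increase norms, so the estimate for w carries over at
  every height r.\<close>

lemma domain_normal_imp_epigraph_normal:
  fixes D :: "'a::euclidean_space set"
  assumes w: "w \<in> frechet_normal_cone D x" and "\<phi> x \<le> r"
  shows "(w, 0) \<in> frechet_normal_cone (real_epigraph D \<phi>) (x, r)"
proof -
  have "\<exists>\<delta>>0. \<forall>y\<in>real_epigraph D \<phi>. norm (y - (x, r)) < \<delta> \<longrightarrow>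
      (w, 0) \<bullet> (y - (x, r)) \<le> \<epsilon> * norm (y - (x, r))" if "\<epsilon> > 0" for \<epsilon>
  proof -
    obtain \<delta> where "\<delta> > 0"
      and \<delta>: "\<And>y. y \<in> D \<Longrightarrow> norm (y - x) < \<delta> \<Longrightarrow> w \<bullet> (y - x) \<le> \<epsilon> * norm (y - x)"
      using w \<open>\<epsilon> > 0\<close> unfolding frechet_normal_cone_def by blast
    have "(w, 0) \<bullet> (y - (x, r)) \<le> \<epsilon> * norm (y - (x, r))"
      if y: "y \<in> real_epigraph D \<phi>" "norm (y - (x, r)) < \<delta>" for y
    proof -
      have le: "norm (fst y - x) \<le> norm (y - (x, r))"
        using norm_fst_le[of "fst y - x" "snd y - r"] by (cases y) simp
      then have "w \<bullet> (fst y - x) \<le> \<epsilon> * norm (fst y - x)"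
        using y by (intro \<delta>) (auto simp: real_epigraph_def)
      also have "\<dots> \<le> \<epsilon> * norm (y - (x, r))" using le \<open>\<epsilon> > 0\<close> by simp
      finally show ?thesis by (cases y) simp
    qed
    then show ?thesis using \<open>\<delta> > 0\<close> by blast
  qed
  then show ?thesis
    using frechet_normal_cone_point[OF w] \<open>\<phi> x \<le> r\<close> by (simp add: frechet_normal_cone_def)
qed

text \<open>Moving down a little stays in the epigraph, so the normal is horizontal. By continuity
  the points (y, r) with y in D near x remain in the epigraph, which turns the estimate for v into
  one on D.\<close>

lemma epigraph_normal_above_graph:
  fixes D :: "'a::euclidean_space set"
  assumes v: "v \<in> frechet_normal_cone (real_epigraph D \<phi>) (x, r)"
    and "\<phi> x < r" and cont: "continuous (at x within D) \<phi>"
  shows "snd v = 0" "fst v \<in> frechet_normal_cone D x"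
proof -
  have x: "x \<in> D" using frechet_normal_cone_point[OF v] by simp
  have "(0, -1) \<bullet> v \<le> 0"
  proof (rule frechet_normal_nonpos_along_ray[OF v])
    show "r - \<phi> x > 0" using \<open>\<phi> x < r\<close> by simp
    show "(x, r) + s *\<^sub>R (0, -1) \<in> real_epigraph D \<phi>" if "s \<le> r - \<phi> x" for s
      using that x by simp
  qed
  then have "snd v \<ge> 0" by (cases v) simp
  then show snd0: "snd v = 0" using epigraph_normal_snd_nonpos[OF v] by simp
  obtain \<delta>1 where "\<delta>1 > 0" and \<delta>1: "\<And>y. y \<in> D \<Longrightarrow> dist y x < \<delta>1 \<Longrightarrow> dist (\<phi> y) (\<phi> x) < r - \<phi> x"
    using cont \<open>\<phi> x < r\<close> unfolding continuous_within_eps_delta by (metis diff_gt_0_iff_gt)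
  have "\<exists>\<delta>>0. \<forall>y\<in>D. norm (y - x) < \<delta> \<longrightarrow> fst v \<bullet> (y - x) \<le> \<epsilon> * norm (y - x)"
    if "\<epsilon> > 0" for \<epsilon>
  proof -
    obtain \<delta> where "\<delta> > 0" and \<delta>: "\<And>y. y \<in> real_epigraph D \<phi> \<Longrightarrow> norm (y - (x, r)) < \<delta> \<Longrightarrow>
        v \<bullet> (y - (x, r)) \<le> \<epsilon> * norm (y - (x, r))"
      using v \<open>\<epsilon> > 0\<close> unfolding frechet_normal_cone_def by blast
    have "fst v \<bullet> (y - x) \<le> \<epsilon> * norm (y - x)" if "y \<in> D" "norm (y - x) < min \<delta> \<delta>1" for y
    proof -
      have "dist (\<phi> y) (\<phi> x) < r - \<phi> x" using that by (intro \<delta>1) (auto simp: dist_norm)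
      then have "\<phi> y \<le> r" by (simp add: dist_real_def)
      then have "v \<bullet> ((y, r) - (x, r)) \<le> \<epsilon> * norm ((y, r) - (x, r))"
        using that by (intro \<delta>) (auto simp: norm_Pair)
      then show ?thesis using snd0 by (cases v) (simp add: norm_Pair)
    qed
    then show ?thesis using \<open>\<delta> > 0\<close> \<open>\<delta>1 > 0\<close> by (intro exI[of _ "min \<delta> \<delta>1"]) auto
  qed
  then show "fst v \<in> frechet_normal_cone D x" using x by (simp add: frechet_normal_cone_def)
qed

text \<open>Rising above the graph only lowers the product with (g, -1), so the first-order error of
  \<phi> bounds it.\<close>

lemma gradient_imp_epigraph_normal:
  fixes D :: "'a::euclidean_space set"
  assumes "x \<in> D" and der: "(\<phi> has_derivative (\<lambda>h. h \<bullet> g)) (at x)"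
  shows "(g, -1) \<in> frechet_normal_cone (real_epigraph D \<phi>) (x, \<phi> x)"
proof -
  have "\<exists>\<delta>>0. \<forall>y\<in>real_epigraph D \<phi>. norm (y - (x, \<phi> x)) < \<delta> \<longrightarrow>
      (g, -1) \<bullet> (y - (x, \<phi> x)) \<le> \<epsilon> * norm (y - (x, \<phi> x))" if "\<epsilon> > 0" for \<epsilon>
  proof -
    obtain \<delta> where "\<delta> > 0" and \<delta>: "\<And>y. norm (y - x) < \<delta> \<Longrightarrow>
        norm (\<phi> y - \<phi> x - (y - x) \<bullet> g) \<le> \<epsilon> * norm (y - x)"
      using der \<open>\<epsilon> > 0\<close> unfolding has_derivative_at_alt by blast
    have "(g, -1) \<bullet> (y - (x, \<phi> x)) \<le> \<epsilon> * norm (y - (x, \<phi> x))"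
      if y: "y \<in> real_epigraph D \<phi>" "norm (y - (x, \<phi> x)) < \<delta>" for y
    proof -
      have le: "norm (fst y - x) \<le> norm (y - (x, \<phi> x))"
        using norm_fst_le[of "fst y - x" "snd y - \<phi> x"] by (cases y) simp
      have "(g, -1) \<bullet> (y - (x, \<phi> x)) = (fst y - x) \<bullet> g - (snd y - \<phi> x)"
        by (cases y) (simp add: inner_commute)
      also have "\<dots> \<le> - (\<phi> (fst y) - \<phi> x - (fst y - x) \<bullet> g)"
        using y by (cases y) simp
      also have "\<dots> \<le> norm (\<phi> (fst y) - \<phi> x - (fst y - x) \<bullet> g)" by simp
      also have "\<dots> \<le> \<epsilon> * norm (fst y - x)" using le y by (intro \<delta>) simp
      also have "\<dots> \<le> \<epsilon> * norm (y - (x, \<phi> x))" using le \<open>\<epsilon> > 0\<close> by simp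
      finally show ?thesis .
    qed
    then show ?thesis using \<open>\<delta> > 0\<close> by blast
  qed
  then show ?thesis using \<open>x \<in> D\<close> by (simp add: frechet_normal_cone_def)
qed

section \<open>Rays starting in epigraphs\<close>

lemma epigraph_ray_at_smooth_point:
  fixes D :: "'a::euclidean_space set"
  assumes "x \<in> interior D" and der: "(\<phi> has_derivative (\<lambda>h. h \<bullet> g)) (at x)"
    and "fst d \<bullet> g < snd d"
  obtains \<eta> where "\<eta> > 0"
    "\<And>s. 0 < s \<Longrightarrow> s < \<eta> \<Longrightarrow> (x, \<phi> x) + s *\<^sub>R d \<in> real_epigraph D \<phi>"
proof -
  obtain \<rho> where "\<rho> > 0" and \<rho>: "ball x \<rho> \<subseteq> D"
    using assms(1) mem_interior by blast
  \<comment> \<open>The height of the graph relative to the ray, up to the constant \<phi> x. Its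
    derivative at 0 is \<open>fst d \<bullet> g - snd d\<close>, which is negative, so the ray rises
    above the graph.\<close>
  define h where "h t = \<phi> (x + t *\<^sub>R fst d) - t * snd d" for t
  have "((\<lambda>t. x + t *\<^sub>R fst d) has_derivative (\<lambda>t. t *\<^sub>R fst d)) (at 0)"
    by (auto intro!: derivative_eq_intros)
  moreover have "(\<phi> has_derivative (\<lambda>h. h \<bullet> g)) (at (x + 0 *\<^sub>R fst d))" using der by simp
  ultimately have "((\<lambda>t. \<phi> (x + t *\<^sub>R fst d)) has_derivative (\<lambda>t. (t *\<^sub>R fst d) \<bullet> g)) (at 0)"
    by (rule has_derivative_compose)
  then have "((\<lambda>t. \<phi> (x + t *\<^sub>R fst d)) has_real_derivative fst d \<bullet> g) (at 0)"
    by (simp add: has_field_derivative_def mult_commute_abs)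
  then have "(h has_real_derivative fst d \<bullet> g - snd d) (at 0)"
    unfolding h_def by (auto intro!: derivative_eq_intros)
  then obtain \<eta> where "\<eta> > 0" and \<eta>: "\<And>s. 0 < s \<Longrightarrow> s < \<eta> \<Longrightarrow> h (0 + s) < h 0"
    using DERIV_neg_dec_right[of h "fst d \<bullet> g - snd d" 0] assms(3) by auto
  \<comment> \<open>The second bound keeps the base point of the ray inside D.\<close>
  define \<eta>' where "\<eta>' = min \<eta> (\<rho> / (norm (fst d) + 1))"
  show ?thesis
  proof
    show "\<eta>' > 0" using \<open>\<eta> > 0\<close> \<open>\<rho> > 0\<close>
      by (auto simp: \<eta>'_def intro!: divide_pos_pos add_nonneg_pos)
    fix s :: real assume s: "0 < s" "s < \<eta>'"
    have "s * norm (fst d) \<le> s * (norm (fst d) + 1)" using s by simp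
    also have "\<dots> < \<rho> / (norm (fst d) + 1) * (norm (fst d) + 1)"
      using s by (intro mult_strict_right_mono) (auto simp: \<eta>'_def intro: add_nonneg_pos)
    also have "\<dots> = \<rho>" using norm_ge_zero[of "fst d"] by (simp add: add_nonneg_eq_0_iff)
    finally have "x + s *\<^sub>R fst d \<in> D" using \<rho> s by (auto simp: dist_norm)
    moreover have "h s < h 0" using \<eta>[of s] s by (simp add: \<eta>'_def)
    ultimately show "(x, \<phi> x) + s *\<^sub>R d \<in> real_epigraph D \<phi>"
      by (cases d) (simp add: h_def)
  qed
qed

text \<open>Near a point strictly above the graph all normals are horizontal with a domain normal as
  first component, so d is nonpositive on them and \<open>ray_stays_in_set\<close> applies around
  (x, r).\<close>

lemma epigraph_ray_above_graph:
  fixes D :: "'a::euclidean_space set"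
  assumes cl: "closed (real_epigraph D \<phi> \<inter> cball z \<epsilon>)"
    and cont: "\<And>y. y \<in> D \<inter> ball (fst z) \<epsilon> \<Longrightarrow> continuous (at y within D) \<phi>"
    and dom: "\<And>w. w \<in> near_normals D (fst z) \<epsilon> \<Longrightarrow> fst d \<bullet> w \<le> 0"
    and x: "(x, r) \<in> real_epigraph D \<phi> \<inter> ball z \<epsilon>" "\<phi> x < r"
  obtains \<eta> where "\<eta> > 0"
    "\<And>s. 0 < s \<Longrightarrow> s < \<eta> \<Longrightarrow> (x, r) + s *\<^sub>R d \<in> real_epigraph D \<phi>"
proof -
  let ?Q = "real_epigraph D \<phi>"
  have fst_ball: "fst y \<in> ball (fst z) \<epsilon>" if "y \<in> ball z \<epsilon>" for y
    using that dist_fst_le[of z y] by auto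
  have xD: "x \<in> D \<inter> ball (fst z) \<epsilon>" using x fst_ball by fastforce
  define m where "m = (r - \<phi> x) / 2"
  have "m > 0" using x by (simp add: m_def)
  obtain \<delta> where "\<delta> > 0" and \<delta>: "\<And>y. y \<in> D \<Longrightarrow> dist y x < \<delta> \<Longrightarrow> dist (\<phi> y) (\<phi> x) < m"
    using cont[OF xD] \<open>m > 0\<close> unfolding continuous_within_eps_delta by metis
  \<comment> \<open>m is half the height above the graph. Within \<epsilon>' both the value of
    \<phi> and the height change by less than m, so points stay strictly above the graph; the last
    term keeps the small ball inside the given one.\<close>
  define \<epsilon>' where "\<epsilon>' = min (min \<delta> m) ((\<epsilon> - dist z (x, r)) / 2)"
  have "\<epsilon>' > 0" using \<open>\<delta> > 0\<close> \<open>m > 0\<close> x by (simp add: \<epsilon>'_def)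
  have sub: "cball (x, r) \<epsilon>' \<subseteq> ball z \<epsilon>"
  proof
    fix y assume "y \<in> cball (x, r) \<epsilon>'"
    then have "dist (x, r) y \<le> (\<epsilon> - dist z (x, r)) / 2" by (simp add: \<epsilon>'_def)
    moreover have "dist z y \<le> dist z (x, r) + dist (x, r) y" by (rule dist_triangle)
    ultimately show "y \<in> ball z \<epsilon>" using x by simp
  qed
  have "?Q \<inter> cball (x, r) \<epsilon>' = (?Q \<inter> cball z \<epsilon>) \<inter> cball (x, r) \<epsilon>'"
    using sub ball_subset_cball by blast
  then have cl': "closed (?Q \<inter> cball (x, r) \<epsilon>')" using cl by (simp add: closed_Int)
  have "d \<bullet> v \<le> 0" if v0: "v \<in> near_normals ?Q (x, r) \<epsilon>'" for v
  proof -
    obtain y where y: "y \<in> ?Q" "y \<in> ball (x, r) \<epsilon>'" and "v \<in> frechet_normal_cone ?Q y"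
      using v0 unfolding near_normals_def by blast
    then have v: "v \<in> frechet_normal_cone ?Q (fst y, snd y)" by simp
    have near: "dist (fst y) x < \<epsilon>'" "dist (snd y) r < \<epsilon>'"
      using y(2) dist_fst_le[of y "(x, r)"] dist_snd_le[of y "(x, r)"] by (auto simp: dist_commute)
    have yD: "fst y \<in> D" using y(1) by (auto simp: real_epigraph_def)
    have yb: "fst y \<in> ball (fst z) \<epsilon>" using y(2) sub ball_subset_cball by (blast intro: fst_ball)
    have "dist (\<phi> (fst y)) (\<phi> x) < m" using near(1) by (intro \<delta> yD) (simp add: \<epsilon>'_def)
    moreover have "dist (snd y) r < m" using near(2) by (simp add: \<epsilon>'_def)
    ultimately have "\<phi> (fst y) < snd y" by (simp add: dist_real_def m_def abs_if split: if_splits)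
    from epigraph_normal_above_graph[OF v this cont]
    have "snd v = 0" "fst v \<in> near_normals D (fst z) \<epsilon>"
      using yD yb by (auto simp: near_normals_def)
    then show ?thesis using dom by (cases d, cases v) auto
  qed
  note ray = ray_stays_in_set[OF cl' this, of "(x, r)"]
  define \<eta> where "\<eta> = \<epsilon>' / (2 * norm d + 1)"
  show ?thesis
  proof
    show "\<eta> > 0" using \<open>\<epsilon>' > 0\<close> by (simp add: \<eta>_def add_nonneg_pos)
    fix s assume s: "0 < s" "s < \<eta>"
    have "2 * (s * norm d) \<le> s * (2 * norm d + 1)" using s by (simp add: algebra_simps)
    also have "\<dots> < \<epsilon>'" using s by (simp add: \<eta>_def pos_less_divide_eq add_nonneg_pos)
    finally show "(x, r) + s *\<^sub>R d \<in> ?Q" using s x by (intro ray) auto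
  qed
qed

text \<open>
  The lines parallel to \<open>d\<close> are parametrised by their intersection with the horizontal
  hyperplane; the set \<open>Z\<close> collects the lines through non-smooth points of the graph. A line
  that avoids \<open>Z\<close> and passes from the interior of the epigraph to its complement would leave
  the epigraph at a point where one of the two preceding lemmas applies.
\<close>

lemma epigraph_recession:
  fixes D :: "'a::euclidean_space set" and \<phi> :: "'a \<Rightarrow> real" and d :: "'a \<times> real"
  defines "Q \<equiv> real_epigraph D \<phi>"
  assumes cl: "closed (Q \<inter> cball z \<epsilon>)" and "\<epsilon> > 0"
    and cont: "\<And>y. y \<in> D \<inter> ball (fst z) \<epsilon> \<Longrightarrow> continuous (at y within D) \<phi>"
    and "c > 0" and e: "\<And>v. v \<in> near_normals Q z \<epsilon> \<Longrightarrow> e \<bullet> v \<le> - c * norm v"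
    and dom: "\<And>w. w \<in> near_normals D (fst z) \<epsilon> \<Longrightarrow> fst d \<bullet> w \<le> 0"
    and "snd d \<noteq> 0" and "negligible Z"
    and smooth: "\<And>y. y \<in> D \<inter> ball (fst z) \<epsilon> \<Longrightarrow> y - (\<phi> y / snd d) *\<^sub>R fst d \<notin> Z \<Longrightarrow>
      y \<in> interior D \<and> (\<exists>g. (\<phi> has_derivative (\<lambda>h. h \<bullet> g)) (at y) \<and> fst d \<bullet> g < snd d)"
  obtains \<eta> where "\<eta> > 0" "\<And>y s. y \<in> Q \<inter> ball z \<eta> \<Longrightarrow> 0 < s \<Longrightarrow> s \<le> \<eta> \<Longrightarrow> y + s *\<^sub>R d \<in> Q"
proof -
  \<comment> \<open>The distance from z to y and the length of the segment along d together use at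
    most half of \<epsilon>; the other half is left for shifting the starting point.\<close>
  define \<eta> where "\<eta> = \<epsilon> / 2 / (1 + norm d)"
  have "1 + norm d > 0" by (simp add: add_pos_nonneg)
  then have "\<eta> > 0" using \<open>\<epsilon> > 0\<close> by (simp add: \<eta>_def)
  have "\<eta> * (1 + norm d) = \<epsilon> / 2" 
    unfolding \<eta>_def by (rule nonzero_eq_divide_eq[THEN iffD1, OF _ refl]) (use \<open>1 + norm d > 0\<close> in simp)
  then have \<eta>_eq: "\<eta> + \<eta> * norm d = \<epsilon> / 2" by (simp add: distrib_left)
  have "y + s *\<^sub>R d \<in> Q" if y: "y \<in> Q \<inter> ball z \<eta>" and s: "0 < s" "s \<le> \<eta>" for y s
  proof (rule ccontr)
    assume out: "y + s *\<^sub>R d \<notin> Q"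
    have sd: "s * norm d \<le> \<eta> * norm d" using s by (simp add: mult_right_mono)
    have "dist z (y + s *\<^sub>R d) \<le> dist z y + s * norm d"
      using dist_triangle[of z "y + s *\<^sub>R d" y] s by (simp add: dist_norm)
    also have "\<dots> < \<epsilon>" using y sd \<eta>_eq \<open>\<epsilon> > 0\<close> by simp
    finally have "y + s *\<^sub>R d \<in> ball z \<epsilon> - (Q \<inter> cball z \<epsilon>)" using out by simp
    moreover have "open (ball z \<epsilon> - (Q \<inter> cball z \<epsilon>))" using cl by (simp add: open_Diff)
    ultimately obtain \<rho> where "\<rho> > 0" and \<rho>: "ball (y + s *\<^sub>R d) \<rho> \<subseteq> ball z \<epsilon> - (Q \<inter> cball z \<epsilon>)"
      unfolding open_contains_ball by blast
    \<comment> \<open>\<open>norm e + c\<close> bounds the length of the shifting direction e'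
      chosen below, and \<open>ray_stays_in_set\<close> asks for twice the length. With \<tau> the
      shift stays below \<rho>, so the endpoint remains outside Q.\<close>
    define K where "K = 2 * (norm e + c)"
    have "K > 0" using \<open>c > 0\<close> by (simp add: K_def add_nonneg_pos)
    define \<tau> where "\<tau> = min \<rho> (\<epsilon> / 2) / (2 * K)"
    have "\<tau> > 0" using \<open>K > 0\<close> \<open>\<rho> > 0\<close> \<open>\<epsilon> > 0\<close> by (simp add: \<tau>_def)
    have "\<tau> * K = min \<rho> (\<epsilon> / 2) / 2" using \<open>K > 0\<close> by (simp add: \<tau>_def)
    then have \<tau>K: "\<tau> * K < \<rho>" "\<tau> * K < \<epsilon> / 2" using \<open>\<rho> > 0\<close> \<open>\<epsilon> > 0\<close> by linarith+
    define z0 where "z0 = y + \<tau> *\<^sub>R e"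
    \<comment> \<open>Where the line through z0 in direction d meets the hyperplane at height 0. A
      ball around p0 is not null, so a nearby p avoids Z.\<close>
    define p0 where "p0 = fst z0 - (snd z0 / snd d) *\<^sub>R fst d"
    have "\<tau> * c > 0" using \<open>\<tau> > 0\<close> \<open>c > 0\<close> by (rule mult_pos_pos)
    then have "ball p0 (\<tau> * c) \<noteq> {}" by simp
    then have "\<not> ball p0 (\<tau> * c) \<subseteq> Z"
      using open_not_negligible[OF open_ball] negligible_subset[OF \<open>negligible Z\<close>] by blast
    then obtain p where "p \<in> ball p0 (\<tau> * c)" "p \<notin> Z" by blast
    \<comment> \<open>The horizontal correction of e that makes the shifted line pass through p.
      Because |a| < c, the corrected direction is still nonpositive on all nearby normals.\<close>
    define a where "a = (p - p0) /\<^sub>R \<tau>"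
    have "norm a = dist p0 p / \<tau>"
      using \<open>\<tau> > 0\<close> by (simp add: a_def dist_norm norm_minus_commute divide_inverse)
    then have na: "norm a < c"
      using \<open>p \<in> ball p0 (\<tau> * c)\<close> \<open>\<tau> > 0\<close> by (simp add: pos_divide_less_eq mult.commute)
    define e' where "e' = e + (a, 0)"
    have e'e: "norm (e' - e) < c" using na by (simp add: e'_def norm_Pair)
    have ne': "norm e' \<le> norm e + c"
      using norm_triangle_ineq[of e "e' - e"] e'e by simp
    then have \<tau>e': "2 * (\<tau> * norm e') \<le> \<tau> * K" using \<open>\<tau> > 0\<close> by (simp add: K_def)
    define z2 where "z2 = y + \<tau> *\<^sub>R e'"
    have "z2 \<in> Q"
      unfolding z2_def
    proof (rule ray_stays_in_set[OF cl])
      fix v assume v: "v \<in> near_normals Q z \<epsilon>"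
      have "(e' - e) \<bullet> v \<le> norm (e' - e) * norm v" by (rule norm_cauchy_schwarz)
      also have "\<dots> \<le> c * norm v" using e'e by (simp add: mult_right_mono)
      finally show "e' \<bullet> v \<le> 0" using e[OF v] by (simp add: inner_diff_left)
    next
      show "dist z y + 2 * (\<tau> * norm e') < \<epsilon>"
      proof -
        have "\<eta> * norm d \<ge> 0" using \<open>\<eta> > 0\<close> by simp
        then show ?thesis using y \<tau>e' \<tau>K(2) \<eta>_eq by simp
      qed
    qed (use y \<open>\<tau> > 0\<close> in auto)
    have z2y: "dist y z2 < \<rho>" "dist y z2 < \<epsilon> / 2"
    proof -
      have "dist y z2 = \<tau> * norm e'" using \<open>\<tau> > 0\<close> by (simp add: z2_def dist_norm)
      moreover have "\<tau> * norm e' \<ge> 0" using \<open>\<tau> > 0\<close> by simp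
      ultimately show "dist y z2 < \<rho>" "dist y z2 < \<epsilon> / 2" using \<tau>e' \<tau>K by linarith+
    qed
    have "z2 + s *\<^sub>R d \<in> ball (y + s *\<^sub>R d) \<rho>" using z2y(1) by (simp add: dist_norm)
    then have "z2 + s *\<^sub>R d \<in> ball z \<epsilon> - (Q \<inter> cball z \<epsilon>)" using \<rho> by blast
    then have out2: "z2 + s *\<^sub>R d \<notin> Q" by auto
    have near: "z2 + t *\<^sub>R d \<in> ball z \<epsilon>" if "0 \<le> t" "t \<le> s" for t
    proof -
      have "t * norm d \<le> s * norm d" using that by (simp add: mult_right_mono)
      then have "norm (t *\<^sub>R d) \<le> \<eta> * norm d" using sd that by simp
      moreover have "dist z (z2 + t *\<^sub>R d) \<le> dist z y + dist y z2 + norm (t *\<^sub>R d)"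
        using dist_triangle[of z "z2 + t *\<^sub>R d" z2] dist_triangle[of z z2 y] by (simp add: dist_norm)
      ultimately show ?thesis using y z2y(2) \<eta>_eq by simp
    qed
    \<comment> \<open>Parameters at which the shifted segment lies in Q. Its maximum t is the last
      such parameter, and t < s as the endpoint is outside.\<close>
    define T where "T = {0..s} \<inter> (\<lambda>t. z2 + t *\<^sub>R d) -` (Q \<inter> cball z \<epsilon>)"
    have "closed T"
      unfolding T_def
      by (intro continuous_closed_preimage cl closed_atLeastAtMost continuous_intros)
    then have "compact T"
      by (metis T_def bounded_closed_interval bounded_subset compact_eq_bounded_closed inf_le1)
    have T_iff: "t \<in> T \<longleftrightarrow> z2 + t *\<^sub>R d \<in> Q" if "0 \<le> t" "t \<le> s" for t
      using near[OF that] that by (auto simp: T_def)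
    have "0 \<in> T" using T_iff[of 0] s \<open>z2 \<in> Q\<close> by simp
    then obtain t where "t \<in> T" and tmax: "\<And>t'. t' \<in> T \<Longrightarrow> t' \<le> t"
      using compact_attains_sup[OF \<open>compact T\<close>] by blast
    then have t: "0 \<le> t" "t \<le> s" by (auto simp: T_def)
    then have tQ: "z2 + t *\<^sub>R d \<in> Q" using T_iff \<open>t \<in> T\<close> by blast
    then have "t < s" using out2 t by (cases "t = s") auto
    obtain x r where xr: "z2 + t *\<^sub>R d = (x, r)" by (cases "z2 + t *\<^sub>R d")
    have xD: "x \<in> D" "\<phi> x \<le> r" using tQ by (auto simp: xr Q_def)
    have xb: "(x, r) \<in> ball z \<epsilon>" using near[OF t] by (simp add: xr)
    then have x: "x \<in> D \<inter> ball (fst z) \<epsilon>" using xD dist_fst_le[of z "(x, r)"] by auto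
    \<comment> \<open>Every point of the line has the same trace p at height 0.\<close>
    have "x - (r / snd d) *\<^sub>R fst d = p"
    proof -
      have "x = fst z0 + (p - p0) + t *\<^sub>R fst d" "r = snd z0 + t * snd d"
        using arg_cong[OF xr, of fst] arg_cong[OF xr, of snd] \<open>\<tau> > 0\<close>
        by (auto simp: z2_def e'_def z0_def a_def algebra_simps)
      then show ?thesis using \<open>snd d \<noteq> 0\<close>
        by (simp add: p0_def add_divide_distrib algebra_simps)
    qed
    then have xZ: "x - (r / snd d) *\<^sub>R fst d \<notin> Z" using \<open>p \<notin> Z\<close> by simp
    \<comment> \<open>On the graph the trace p outside Z provides a smooth point; above it
      continuity applies. Either way the line continues in Q after t, contradicting
      maximality.\<close>
    obtain \<eta>' where "\<eta>' > 0" and \<eta>': "\<And>s. 0 < s \<Longrightarrow> s < \<eta>' \<Longrightarrow> (x, r) + s *\<^sub>R d \<in> Q"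
    proof (cases "\<phi> x = r")
      case True
      then obtain g where "x \<in> interior D" "(\<phi> has_derivative (\<lambda>h. h \<bullet> g)) (at x)" "fst d \<bullet> g < snd d"
        using smooth[OF x] xZ by blast
      from epigraph_ray_at_smooth_point[OF this] that show ?thesis
        unfolding Q_def True by blast
    next
      case False
      then have "\<phi> x < r" using xD by simp
      have "(x, r) \<in> real_epigraph D \<phi> \<inter> ball z \<epsilon>" using xD xb by simp
      from epigraph_ray_above_graph[OF cl[unfolded Q_def] cont dom this \<open>\<phi> x < r\<close>] that
      show ?thesis unfolding Q_def by blast
    qed
    define h where "h = min (s - t) (\<eta>' / 2)"
    have h: "0 < h" "h < \<eta>'" "t + h \<le> s" using \<open>t < s\<close> \<open>\<eta>' > 0\<close> by (auto simp: h_def)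
    have "z2 + (t + h) *\<^sub>R d = (x, r) + h *\<^sub>R d" by (simp add: algebra_simps flip: xr)
    then have "z2 + (t + h) *\<^sub>R d \<in> Q" using \<eta>'[OF h(1,2)] by simp
    then have "t + h \<in> T" using T_iff[of "t + h"] t h by simp
    then show False using tmax h by force
  qed
  then show ?thesis using that \<open>\<eta> > 0\<close> by blast
qed

section \<open>Gradients on open strata\<close>

lemma C2_on_UNIV_gradient:
  fixes g :: "'a::euclidean_space \<Rightarrow> real"
  assumes "C2_on g UNIV"
  obtains \<gamma> where "\<And>y. (g has_derivative (\<lambda>h. h \<bullet> \<gamma> y)) (at y)" "continuous_on UNIV \<gamma>"
proof -
  obtain g1 g2 where g1: "\<And>y. (g has_derivative blinfun_apply (g1 y)) (at y)"
    and g2: "\<And>y. (g1 has_derivative blinfun_apply (g2 y)) (at y)"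
    using assms unfolding C2_on_def by blast
  \<comment> \<open>The vector representing the derivative \<open>g1 y\<close> through the inner
    product.\<close>
  define \<gamma> where "\<gamma> y = (\<Sum>b\<in>Basis. g1 y b *\<^sub>R b)" for y
  have "blinfun_apply (g1 y) = (\<lambda>h. h \<bullet> \<gamma> y)" for y
  proof
    fix h
    have "g1 y h = g1 y (\<Sum>b\<in>Basis. (h \<bullet> b) *\<^sub>R b)" by (simp add: euclidean_representation)
    also have "\<dots> = (\<Sum>b\<in>Basis. (h \<bullet> b) * g1 y b)"
      by (simp add: blinfun.sum_right blinfun.scaleR_right)
    also have "\<dots> = h \<bullet> \<gamma> y" by (simp add: \<gamma>_def inner_sum_right mult.commute)
    finally show "g1 y h = h \<bullet> \<gamma> y" .
  qed
  then have "(g has_derivative (\<lambda>h. h \<bullet> \<gamma> y)) (at y)" for y using g1 by metis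
  moreover have "continuous_on UNIV g1"
    using g2 by (meson continuous_at_imp_continuous_on has_derivative_continuous)
  then have "continuous_on UNIV \<gamma>" unfolding \<gamma>_def by (intro continuous_intros)
  ultimately show ?thesis by (rule that)
qed

lemma open_stratum_gradient:
  fixes f :: "'a::euclidean_space \<Rightarrow> ereal"
  assumes f: "C2_smooth_on_stratum f M" and "open M" "x \<in> M"
  obtains \<gamma> W where "open W" "x \<in> W" "W \<subseteq> M" "\<And>y. y \<in> W \<Longrightarrow> \<bar>f y\<bar> \<noteq> \<infinity>"
    "\<And>y. y \<in> W \<Longrightarrow> ((\<lambda>y. real_of_ereal (f y)) has_derivative (\<lambda>h. h \<bullet> \<gamma> y)) (at y)"
    "continuous_on UNIV \<gamma>"
proof -
  have "\<exists>U (g :: 'a \<Rightarrow> real).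
      open U \<and> x \<in> U \<and> C2_on g UNIV \<and> (\<forall>y\<in>M \<inter> U. f y = ereal (g y))"
    using f \<open>x \<in> M\<close> by (simp only: C2_smooth_on_stratum_def)
  then obtain U and g :: "'a \<Rightarrow> real" where U: "open U" "x \<in> U" and g: "C2_on g UNIV"
    and fg: "\<forall>y\<in>M \<inter> U. f y = ereal (g y)"
    by (elim exE conjE)
  obtain \<gamma> where \<gamma>: "\<And>y. (g has_derivative (\<lambda>h. h \<bullet> \<gamma> y)) (at y)" "continuous_on UNIV \<gamma>"
    using C2_on_UNIV_gradient[OF g] by blast
  show ?thesis
  proof (rule that)
    show "open (M \<inter> U)" "x \<in> M \<inter> U" "M \<inter> U \<subseteq> M" using U assms by auto
    show "continuous_on UNIV \<gamma>" by (rule \<gamma>)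
    fix y assume y: "y \<in> M \<inter> U"
    then show "\<bar>f y\<bar> \<noteq> \<infinity>" using fg by simp
    show "((\<lambda>y. real_of_ereal (f y)) has_derivative (\<lambda>h. h \<bullet> \<gamma> y)) (at y)"
      by (rule has_derivative_transform_within_open[OF \<gamma>(1) \<open>open (M \<inter> U)\<close> y]) (use fg in simp)
  qed
qed

lemma gradients_mono: "A \<subseteq> B \<Longrightarrow> gradients f A \<subseteq> gradients f B"
  unfolding gradients_def by blast

section \<open>Slices and separators of cones over gradients\<close>

lemma convex_cone_closure:
  fixes S :: "'a::real_normed_vector set"
  assumes "convex_cone S"
  shows "convex_cone (closure S)"
  unfolding convex_cone_def
proof (intro conjI)
  show "closure S \<noteq> {}" "convex (closure S)"
    using assms by (auto simp: convex_cone_def convex_closure)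
  show "conic (closure S)"
    using assms by (auto simp: convex_cone_def conic_def intro!: closure_scaleR_mem)
qed

text \<open>Elements of the cone at negative height rescale to height -1, where the slice is the
  convex hull of G. An approximating sequence has heights tending to -1, so rescaling does not
  change its limit.\<close>

lemma closure_hull_horizontal_slice:
  fixes G :: "'a::euclidean_space set"
  assumes "(u, -1) \<in> closure (convex_cone hull (G \<times> {-1::real}))"
  shows "u \<in> closure (convex hull G)"
proof -
  obtain p where p: "\<And>n. p n \<in> convex_cone hull (G \<times> {-1::real})" and lim: "p \<longlonglongrightarrow> (u, -1)"
    using assms unfolding closure_sequential by blast
  have hull: "convex hull (G \<times> {-1::real}) = (convex hull G) \<times> {-1}"
    by (simp add: convex_hull_Times)
  have slice: "fst q /\<^sub>R (- snd q) \<in> convex hull G"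
    if "q \<in> convex_cone hull (G \<times> {-1::real})" "snd q < 0" for q
  proof -
    have "q \<noteq> 0" using that by auto
    then have "q \<in> conic hull ((convex hull G) \<times> {-1})"
      using that unfolding convex_cone_hull_separate hull by blast
    then obtain c g where "c \<ge> 0" "g \<in> convex hull G" "q = c *\<^sub>R (g, -1)"
      unfolding conic_hull_explicit by blast
    then show ?thesis using that by simp
  qed
  have snd_lim: "(\<lambda>n. snd (p n)) \<longlonglongrightarrow> -1" using tendsto_snd[OF lim] by simp
  have "(\<lambda>n. fst (p n) /\<^sub>R (- snd (p n))) \<longlonglongrightarrow> u /\<^sub>R (- (-1))"
    using tendsto_fst[OF lim] by (intro tendsto_intros snd_lim) auto
  then have lim_u: "(\<lambda>n. fst (p n) /\<^sub>R (- snd (p n))) \<longlonglongrightarrow> u" by simp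
  show ?thesis
  proof (rule Lim_in_closed_set[OF closed_closure _ sequentially_bot lim_u])
    have "\<forall>\<^sub>F n in sequentially. snd (p n) < 0" using snd_lim by (rule order_tendstoD) simp
    then show "\<forall>\<^sub>F n in sequentially. fst (p n) /\<^sub>R (- snd (p n)) \<in> closure (convex hull G)"
      by eventually_elim (use slice[OF p] closure_subset in blast)
  qed
qed

text \<open>Lines in direction d are described by their trace on a horizontal hyperplane, so d must
  not be horizontal. Strict separation has a uniform gap on N and survives a small vertical
  tilt.\<close>

lemma separation_nonhorizontal:
  fixes N :: "('a::euclidean_space \<times> real) set"
  assumes "closed N" "conic N" and e: "\<And>n. n \<in> N \<Longrightarrow> n \<noteq> 0 \<Longrightarrow> e \<bullet> n < 0"
    and v: "v \<notin> convex_cone hull N"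
  obtains d where "\<And>n. n \<in> N \<Longrightarrow> n \<noteq> 0 \<Longrightarrow> d \<bullet> n < 0" "d \<bullet> v > 0" "snd d \<noteq> 0"
proof -
  obtain d where d: "\<And>n. n \<in> N \<Longrightarrow> n \<noteq> 0 \<Longrightarrow> d \<bullet> n < 0" "d \<bullet> v > 0"
    using convex_cone_hull_separation[OF assms] by blast
  obtain c where "c > 0" and c: "\<And>n. n \<in> N \<Longrightarrow> d \<bullet> n \<le> - c * norm n"
    using closed_conic_gap[OF assms(1,2) d(1)] by blast
  show ?thesis
  proof (cases "snd d = 0")
    case False
    then show ?thesis using that d by blast
  next
    case True
    \<comment> \<open>The tilt costs at most half of the gap on N and half of d \<bullet> v.\<close>
    define \<tau> where "\<tau> = min (c / 2) (d \<bullet> v / 2 / (norm v + 1))"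
    have nv: "norm v + 1 > 0" by (simp add: add_nonneg_pos)
    have "\<tau> > 0" using \<open>c > 0\<close> d(2) nv by (simp add: \<tau>_def)
    have bound: "\<bar>(0, \<tau>) \<bullet> n\<bar> \<le> \<tau> * norm n" for n :: "'a \<times> real"
      using Cauchy_Schwarz_ineq2[of "(0, \<tau>)" n] \<open>\<tau> > 0\<close> by (simp add: norm_Pair)
    show ?thesis
    proof (rule that)
      fix n assume n: "n \<in> N" "n \<noteq> 0"
      have "\<tau> \<le> c / 2" unfolding \<tau>_def by (rule min.cobounded1)
      then have "\<tau> * norm n \<le> c / 2 * norm n" by (intro mult_right_mono) auto
      moreover have "c * norm n > 0" using n \<open>c > 0\<close> by simp
      ultimately show "(d + (0, \<tau>)) \<bullet> n < 0"
        using c[OF n(1)] bound[of n] by (simp only: inner_add_left)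
    next
      have "\<tau> * norm v \<le> \<tau> * (norm v + 1)" using \<open>\<tau> > 0\<close> by simp
      also have "\<dots> \<le> d \<bullet> v / 2 / (norm v + 1) * (norm v + 1)"
        unfolding \<tau>_def using nv by (intro mult_right_mono min.cobounded2) simp
      also have "\<dots> = d \<bullet> v / 2"
        by (rule nonzero_eq_divide_eq[THEN iffD1, OF _ refl]) (use nv in simp)
      finally have "\<bar>(0, \<tau>) \<bullet> v\<bar> \<le> d \<bullet> v / 2" using bound[of v] by linarith
      then have "- (d \<bullet> v / 2) \<le> (0, \<tau>) \<bullet> v" by linarith
      then show "(d + (0, \<tau>)) \<bullet> v > 0" using d(2) by (simp only: inner_add_left)
      show "snd (d + (0, \<tau>)) \<noteq> 0" using True \<open>\<tau> > 0\<close> by simp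
    qed
  qed
qed

text \<open>Only finitely many strata matter near x0. Those of lower dimension have null sheared
  graphs, whose union is Z; a point whose trace avoids Z must lie in an open stratum.\<close>

lemma stratified_smooth_off_negligible:
  fixes f :: "'a::euclidean_space \<Rightarrow> ereal"
  assumes "locally_finite_stratification D \<M>" and C2: "\<And>M. M \<in> \<M> \<Longrightarrow> C2_smooth_on_stratum f M"
    and "x0 \<in> D"
  obtains \<epsilon> Z where "\<epsilon> > 0" "negligible Z"
    "\<And>x. x \<in> D \<inter> ball x0 \<epsilon> \<Longrightarrow> x - real_of_ereal (f x) *\<^sub>R a \<notin> Z \<Longrightarrow>
      \<exists>W \<gamma>. open W \<and> x \<in> W \<and> W \<subseteq> D \<and> (\<forall>y\<in>W. \<bar>f y\<bar> \<noteq> \<infinity>) \<and>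
        (\<forall>y\<in>W. ((\<lambda>y. real_of_ereal (f y)) has_derivative (\<lambda>h. h \<bullet> \<gamma> y)) (at y)) \<and>
        continuous_on UNIV \<gamma>"
proof -
  have part: "partition_on D \<M>" and mfd: "\<And>M. M \<in> \<M> \<Longrightarrow> \<exists>r. C2_submanifold r M"
    using assms(1) unfolding locally_finite_stratification_def by blast+
  obtain U where "open U" "x0 \<in> U" and fin: "finite {M \<in> \<M>. M \<inter> U \<noteq> {}}"
    using assms(1) \<open>x0 \<in> D\<close> unfolding locally_finite_stratification_def by blast
  obtain \<epsilon> where "\<epsilon> > 0" "ball x0 \<epsilon> \<subseteq> U" using \<open>open U\<close> \<open>x0 \<in> U\<close> open_contains_ball by blast
  define \<Phi> where "\<Phi> x = x - real_of_ereal (f x) *\<^sub>R a" for x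
  define Z where "Z = (\<Union>M\<in>{M \<in> \<M>. M \<inter> U \<noteq> {} \<and> negligible M}. \<Phi> ` M)"
  have "negligible Z"
    unfolding Z_def
  proof (rule negligible_Union)
    show "finite ((`) \<Phi> ` {M \<in> \<M>. M \<inter> U \<noteq> {} \<and> negligible M})"
      by (intro finite_imageI finite_subset[OF _ fin]) auto
    fix T assume "T \<in> (`) \<Phi> ` {M \<in> \<M>. M \<inter> U \<noteq> {} \<and> negligible M}"
    then obtain M where "M \<in> \<M>" "negligible M" "T = \<Phi> ` M" by blast
    then show "negligible T"
      unfolding \<Phi>_def using negligible_sheared_graph[OF C2] by blast
  qed
  have smooth: "\<exists>W \<gamma>. open W \<and> x \<in> W \<and> W \<subseteq> D \<and> (\<forall>y\<in>W. \<bar>f y\<bar> \<noteq> \<infinity>) \<and>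
        (\<forall>y\<in>W. ((\<lambda>y. real_of_ereal (f y)) has_derivative (\<lambda>h. h \<bullet> \<gamma> y)) (at y)) \<and>
        continuous_on UNIV \<gamma>"
    if x: "x \<in> D \<inter> ball x0 \<epsilon>" "\<Phi> x \<notin> Z" for x
  proof -
    obtain M where M: "M \<in> \<M>" "x \<in> M" using x part by (auto simp: partition_on_def)
    then have "M \<inter> U \<noteq> {}" using x \<open>ball x0 \<epsilon> \<subseteq> U\<close> by blast
    then have "\<not> negligible M" using x M by (auto simp: Z_def)
    moreover obtain r where r: "C2_submanifold r M" using mfd M by blast
    ultimately have "open M"
      using negligible_C2_submanifold[OF r] open_C2_submanifold[of M] by auto
    show ?thesis
    proof (rule open_stratum_gradient[OF C2[OF M(1)] \<open>open M\<close> M(2)])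
      fix \<gamma> and W :: "'a set"
      assume W: "open W" "x \<in> W" "W \<subseteq> M" "\<And>y. y \<in> W \<Longrightarrow> \<bar>f y\<bar> \<noteq> \<infinity>"
        "\<And>y. y \<in> W \<Longrightarrow> ((\<lambda>y. real_of_ereal (f y)) has_derivative (\<lambda>h. h \<bullet> \<gamma> y)) (at y)"
        "continuous_on UNIV \<gamma>"
      have "W \<subseteq> D" using W(3) M(1) part by (auto simp: partition_on_def)
      then show ?thesis
        using W by (intro exI[of _ W] exI[of _ \<gamma>] conjI ballI)
    qed
  qed
  show ?thesis
    by (rule that[OF \<open>\<epsilon> > 0\<close> \<open>negligible Z\<close>]) (rule smooth[unfolded \<Phi>_def])
qed

text \<open>By continuity at x0, graph points over a small neighbourhood of x0 are close to (x0,
  \<phi> x0).\<close>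

lemma near_graph_normals:
  fixes D :: "'a::euclidean_space set"
  assumes "x0 \<in> D" and cont: "continuous (at x0 within D) \<phi>" and "\<delta> > 0"
  shows "\<exists>\<delta>'>0. \<forall>x\<in>D \<inter> ball x0 \<delta>'.
    frechet_normal_cone (real_epigraph D \<phi>) (x, \<phi> x)
      \<subseteq> near_normals (real_epigraph D \<phi>) (x0, \<phi> x0) \<delta>"
proof -
  obtain \<delta>1 where "\<delta>1 > 0"
    and \<delta>1: "\<And>y. y \<in> D \<Longrightarrow> dist y x0 < \<delta>1 \<Longrightarrow> dist (\<phi> y) (\<phi> x0) < \<delta> / 2"
    using cont \<open>\<delta> > 0\<close> unfolding continuous_within_eps_delta by (metis half_gt_zero)
  show ?thesis
  proof (intro exI conjI ballI subsetI)
    show "min \<delta>1 (\<delta> / 2) > 0" using \<open>\<delta>1 > 0\<close> \<open>\<delta> > 0\<close> by simp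
    fix x v assume x: "x \<in> D \<inter> ball x0 (min \<delta>1 (\<delta> / 2))"
      and v: "v \<in> frechet_normal_cone (real_epigraph D \<phi>) (x, \<phi> x)"
    have "dist (x0, \<phi> x0) (x, \<phi> x) \<le> dist x0 x + dist (\<phi> x0) (\<phi> x)"
      using sqrt_sum_squares_le_sum[of "dist x0 x" "dist (\<phi> x0) (\<phi> x)"] by (simp add: dist_Pair_Pair)
    also have "\<dots> < \<delta>" using x \<delta>1[of x] by (simp add: dist_commute)
    finally show "v \<in> near_normals (real_epigraph D \<phi>) (x0, \<phi> x0) \<delta>"
      using v x by (auto simp: near_normals_def)
  qed
qed

section \<open>The gradient formula\<close>

text \<open>Properness excludes the value -\<infinity>, at which the epigraph contains a whole
  vertical line while \<open>real_of_ereal\<close> returns 0.\<close>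

lemma ereal_epigraph_eq_real_epigraph:
  assumes "proper_function f"
  shows "ereal_epigraph f = real_epigraph (effective_domain f) (\<lambda>x. real_of_ereal (f x))"
proof -
  have "f x \<le> ereal r \<longleftrightarrow> f x < \<infinity> \<and> real_of_ereal (f x) \<le> r" for x r
    using assms by (cases "f x") (auto simp: proper_function_def)
  then show ?thesis by (auto simp: ereal_epigraph_def real_epigraph_def effective_domain_def)
qed

lemma continuous_real_of_ereal:
  assumes "\<bar>f x\<bar> \<noteq> \<infinity>" "continuous (at x within D) f"
  shows "continuous (at x within D) (\<lambda>x. real_of_ereal (f x))"
  using assms unfolding continuous_within by (intro lim_real_of_ereal) (simp add: ereal_real')

lemma gradients_iff:
  "g \<in> gradients f A \<longleftrightarrow> (\<exists>x\<in>A. (\<forall>\<^sub>F y in nhds x. \<bar>f y\<bar> \<noteq> \<infinity>) \<and>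
    ((\<lambda>y. real_of_ereal (f y)) has_derivative (\<lambda>h. h \<bullet> g)) (at x))"
  by (simp add: gradients_def gderiv_def)

text \<open>x itself may lie outside \<Omega>, but \<Omega> has points of W arbitrarily close to x,
  and their gradients approach \<open>\<gamma> x\<close> by continuity.\<close>

lemma dense_gradient_near:
  fixes f :: "'a::euclidean_space \<Rightarrow> ereal"
  assumes "open W" "x \<in> W" "W \<subseteq> D" and fin: "\<And>y. y \<in> W \<Longrightarrow> \<bar>f y\<bar> \<noteq> \<infinity>"
    and der: "\<And>y. y \<in> W \<Longrightarrow> ((\<lambda>y. real_of_ereal (f y)) has_derivative (\<lambda>h. h \<bullet> \<gamma> y)) (at y)"
    and cont: "continuous_on UNIV \<gamma>" and dense: "D \<subseteq> closure \<Omega>" and "x \<in> ball x0 \<delta>"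
  shows "\<gamma> x \<in> closure (gradients f (\<Omega> \<inter> ball x0 \<delta>))"
  unfolding closure_approachable
proof (intro allI impI)
  fix e :: real assume "e > 0"
  obtain \<rho> where "\<rho> > 0" and \<rho>: "\<And>y. dist y x < \<rho> \<Longrightarrow> dist (\<gamma> y) (\<gamma> x) < e"
    using cont \<open>e > 0\<close> unfolding continuous_on_iff by blast
  have "open (W \<inter> ball x0 \<delta> \<inter> ball x \<rho>)" using \<open>open W\<close> by auto
  moreover have "x \<in> W \<inter> ball x0 \<delta> \<inter> ball x \<rho>" using assms \<open>\<rho> > 0\<close> by auto
  moreover have "x \<in> closure \<Omega>" using assms by blast
  ultimately obtain y where y: "y \<in> \<Omega>" "y \<in> W \<inter> ball x0 \<delta> \<inter> ball x \<rho>"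
    using open_Int_closure_eq_empty[of "W \<inter> ball x0 \<delta> \<inter> ball x \<rho>" \<Omega>] by blast
  have "\<forall>\<^sub>F z in nhds y. \<bar>f z\<bar> \<noteq> \<infinity>"
    by (rule eventually_mono[OF eventually_nhds_in_open[OF \<open>open W\<close>]]) (use y fin in auto)
  then have "\<gamma> y \<in> gradients f (\<Omega> \<inter> ball x0 \<delta>)"
    unfolding gradients_iff using y der by blast
  moreover have "dist (\<gamma> y) (\<gamma> x) < e" using y by (intro \<rho>) (simp add: dist_commute)
  ultimately show "\<exists>g\<in>gradients f (\<Omega> \<inter> ball x0 \<delta>). dist g (\<gamma> x) < e" by blast
qed

lemma clarke_subdifferential_gradient_formula:
  fixes f :: "'a::euclidean_space \<Rightarrow> ereal" and x0 :: 'a and \<Omega> :: "'a set"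
  assumes proper: "proper_function f" and strat: "stratifiable f" and fin0: "\<bar>f x0\<bar> \<noteq> \<infinity>"
    and dirlip: "directionally_lipschitzian_at f x0"
    and "open U" "x0 \<in> U"
    and cont: "\<And>x. x \<in> U \<inter> effective_domain f \<Longrightarrow> continuous (at x within effective_domain f) f"
    and \<Omega>: "\<Omega> \<subseteq> effective_domain f" "effective_domain f \<subseteq> closure \<Omega>"
  shows "clarke_subdifferential f x0 =
    {u + w | u w. u \<in> (\<Inter>\<delta>\<in>{0<..}. closure (convex hull (gradients f (\<Omega> \<inter> ball x0 \<delta>)))) \<and>
       w \<in> clarke_normal_cone (effective_domain f) x0}"
proof -

  \<comment> \<open>Notation and the normal cone of the epigraph\<close>
  define D where "D = effective_domain f"
  define \<phi> where "\<phi> x = real_of_ereal (f x)" for x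
  define Q where "Q = real_epigraph D \<phi>"
  define z where "z = (x0, \<phi> x0)"
  define N where "N = limiting_normal_cone Q z"
  define ND where "ND = limiting_normal_cone D x0"
  define G where "G \<delta> = gradients f (\<Omega> \<inter> ball x0 \<delta>)" for \<delta>
  have Q_eq: "ereal_epigraph f = Q"
    unfolding Q_def D_def \<phi>_def using proper by (rule ereal_epigraph_eq_real_epigraph)
  have finD: "\<bar>f x\<bar> \<noteq> \<infinity>" if "x \<in> D" for x
    using that proper by (auto simp: D_def effective_domain_def proper_function_def)
  have "x0 \<in> D" using fin0 by (cases "f x0") (auto simp: D_def effective_domain_def)
  then have zQ: "z \<in> Q" by (simp add: z_def Q_def)
  have cont_\<phi>: "continuous (at x within D) \<phi>" if "x \<in> D \<inter> U" for x
    unfolding \<phi>_def using that cont[of x] finD by (intro continuous_real_of_ereal) (auto simp: D_def)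
  have cont0: "continuous (at x0 within D) \<phi>" using cont_\<phi> \<open>x0 \<in> D\<close> \<open>x0 \<in> U\<close> by blast
  have \<Omega>D: "\<Omega> \<subseteq> D" "D \<subseteq> closure \<Omega>" using \<Omega> by (auto simp: D_def)

  have clN: "closed N" and conN: "conic N"
    unfolding N_def by (rule closed_limiting_normal_cone conic_limiting_normal_cone)+
  have N_eq: "N = (\<Inter>\<delta>\<in>{0<..}. closure (near_normals Q z \<delta>))"
    unfolding N_def using zQ by (rule limiting_normal_cone_eq)
  have ND_eq: "ND = (\<Inter>\<delta>\<in>{0<..}. closure (near_normals D x0 \<delta>))"
    unfolding ND_def using \<open>x0 \<in> D\<close> by (rule limiting_normal_cone_eq)
  have NC: "clarke_normal_cone Q z = closure (convex_cone hull N)"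
    unfolding N_def using zQ by (rule clarke_normal_cone_eq)
  have NDC: "clarke_normal_cone D x0 = closure (convex_cone hull ND)"
    unfolding ND_def using \<open>x0 \<in> D\<close> by (rule clarke_normal_cone_eq)
  \<comment> \<open>The horizon subdifferential is the slice of N at height 0.\<close>
  have "pointed N"
    unfolding N_def Q_def
  proof (rule pointed_epigraph_limiting_normal_cone)
    have "horizon_subdifferential f x0 = {v. (v, 0) \<in> limiting_normal_cone (real_epigraph D \<phi>) z}"
      using fin0 by (simp add: horizon_subdifferential_def Q_eq[unfolded Q_def] z_def \<phi>_def)
    then show "pointed {v. (v, 0) \<in> limiting_normal_cone (real_epigraph D \<phi>) z}"
      using dirlip by (simp add: directionally_lipschitzian_at_def)
  qed
  then obtain e where e: "\<And>n. n \<in> N \<Longrightarrow> n \<noteq> 0 \<Longrightarrow> e \<bullet> n < 0"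
    using pointed_imp_strict_direction[OF clN conN] by blast

  have near: "\<exists>\<delta>'>0. \<forall>x\<in>D \<inter> ball x0 \<delta>'. frechet_normal_cone Q (x, \<phi> x) \<subseteq> near_normals Q z \<delta>"
    if "\<delta> > 0" for \<delta>
    unfolding Q_def z_def by (rule near_graph_normals[OF \<open>x0 \<in> D\<close> cont0 that])
  have G_normal: "\<exists>x\<in>D \<inter> ball x0 \<delta>. (g, -1) \<in> frechet_normal_cone Q (x, \<phi> x)" if "g \<in> G \<delta>" for g \<delta>
  proof -
    obtain x where x: "x \<in> \<Omega> \<inter> ball x0 \<delta>" and "(\<phi> has_derivative (\<lambda>h. h \<bullet> g)) (at x)"
      using \<open>g \<in> G \<delta>\<close> unfolding G_def gradients_iff \<phi>_def by blast
    then show ?thesis unfolding Q_def using \<Omega>D gradient_imp_epigraph_normal by blast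
  qed

  \<comment> \<open>Cones of limiting gradients and of domain normals\<close>
  define A where "A \<delta> = conic hull (G \<delta> \<times> {-1::real})" for \<delta>
  \<comment> \<open>Taking the outer limit of cones, rather than of gradients, also records
    horizontal limits of multiples of (g, -1) when gradients are unbounded.\<close>
  define A0 where "A0 = (\<Inter>\<delta>\<in>{0<..}. closure (A \<delta>))"
  define B where "B = ND \<times> {0::real}"
  have A_near: "\<exists>\<delta>'>0. A \<delta>' \<subseteq> near_normals Q z \<delta>" if pos: "\<delta> > 0" for \<delta>
  proof -
    obtain \<delta>' where "\<delta>' > 0"
      and \<delta>': "\<And>x. x \<in> D \<inter> ball x0 \<delta>' \<Longrightarrow> frechet_normal_cone Q (x, \<phi> x) \<subseteq> near_normals Q z \<delta>"
      using near[OF pos] by blast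
    have "A \<delta>' \<subseteq> near_normals Q z \<delta>"
      unfolding A_def
    proof (rule hull_minimal)
      show "conic (near_normals Q z \<delta>)" by (simp add: conic_def near_normals_scaleR)
      show "G \<delta>' \<times> {-1} \<subseteq> near_normals Q z \<delta>" using G_normal \<delta>' by blast
    qed
    then show ?thesis using \<open>\<delta>' > 0\<close> by blast
  qed
  have "A0 \<subseteq> N"
    unfolding N_eq
  proof (rule INT_greatest)
    fix \<delta> :: real assume "\<delta> \<in> {0<..}"
    then obtain \<delta>' where "\<delta>' > 0" "A \<delta>' \<subseteq> near_normals Q z \<delta>" using A_near by auto
    then show "A0 \<subseteq> closure (near_normals Q z \<delta>)"
      unfolding A0_def using closure_mono by blast
  qed
  have "B \<subseteq> N"
    unfolding N_eq
  proof (rule INT_greatest)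
    fix \<delta> :: real assume "\<delta> \<in> {0<..}"
    then obtain \<delta>' where "\<delta>' > 0"
      and \<delta>': "\<And>x. x \<in> D \<inter> ball x0 \<delta>' \<Longrightarrow> frechet_normal_cone Q (x, \<phi> x) \<subseteq> near_normals Q z \<delta>"
      using near[of \<delta>] by auto
    have "near_normals D x0 \<delta>' \<times> {0} \<subseteq> near_normals Q z \<delta>"
    proof
      fix v assume "v \<in> near_normals D x0 \<delta>' \<times> {0::real}"
      then obtain w x where v: "v = (w, 0)" "x \<in> D \<inter> ball x0 \<delta>'" and w: "w \<in> frechet_normal_cone D x"
        unfolding near_normals_def by blast
      then show "v \<in> near_normals Q z \<delta>"
        using \<delta>'[OF v(2)] domain_normal_imp_epigraph_normal[OF w order_refl, of \<phi>]
        unfolding Q_def by blast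
    qed
    then have "closure (near_normals D x0 \<delta>') \<times> {0} \<subseteq> closure (near_normals Q z \<delta>)"
      using closure_mono[of "near_normals D x0 \<delta>' \<times> {0::real}"]
      by (simp add: closure_Times closure_closed[OF closed_singleton])
    then show "B \<subseteq> closure (near_normals Q z \<delta>)"
      unfolding B_def ND_eq using \<open>\<delta>' > 0\<close> by blast
  qed

  \<comment> \<open>Inclusion from right to left\<close>
  have super: "u + w \<in> clarke_subdifferential f x0"
    if u: "u \<in> (\<Inter>\<delta>\<in>{0<..}. closure (convex hull G \<delta>))" and w: "w \<in> clarke_normal_cone D x0" for u w
  proof -
    have "(u, -1) \<in> convex_cone hull N"
    proof (rule ccontr)
      assume "(u, -1) \<notin> convex_cone hull N"
      then obtain d where d: "\<And>n. n \<in> N \<Longrightarrow> n \<noteq> 0 \<Longrightarrow> d \<bullet> n < 0" "d \<bullet> (u, -1) > 0"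
        using convex_cone_hull_separation[OF clN conN e] by blast
      \<comment> \<open>Strict negativity on N spreads to all normals near z, hence to (g, -1) for
        gradients g near x0. These g, and with them u, lie in a closed half-space, which contradicts
        d \<bullet> (u, -1) > 0.\<close>
      obtain c \<delta> where "c > 0" "\<delta> > 0" and gap: "\<And>v. v \<in> near_normals Q z \<delta> \<Longrightarrow> d \<bullet> v \<le> - c * norm v"
        using limiting_normal_cone_gap[OF zQ d(1)[unfolded N_def]] by blast
      obtain \<delta>' where "\<delta>' > 0" and A_sub: "A \<delta>' \<subseteq> near_normals Q z \<delta>"
        using A_near[OF \<open>\<delta> > 0\<close>] by blast
      have "G \<delta>' \<subseteq> {g. fst d \<bullet> g \<le> snd d}"
      proof
        fix g assume "g \<in> G \<delta>'"
        then have "(g, -1) \<in> A \<delta>'" unfolding A_def by (intro hull_inc) simp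
        then have "d \<bullet> (g, -1) \<le> - c * norm (g, -1::real)" using gap A_sub by blast
        also have "\<dots> \<le> 0" using \<open>c > 0\<close> by simp
        finally show "g \<in> {g. fst d \<bullet> g \<le> snd d}" by (cases d) simp
      qed
      then have "closure (convex hull G \<delta>') \<subseteq> {g. fst d \<bullet> g \<le> snd d}"
        by (intro closure_minimal hull_minimal convex_halfspace_le closed_halfspace_le)
      then show False using u \<open>\<delta>' > 0\<close> d(2) by (cases d) auto
    qed
    then have 1: "(u, -1) \<in> closure (convex_cone hull N)" using closure_subset by blast
    \<comment> \<open>The linear embedding of w as (w, 0) commutes with generating cones and carries
      ND into N.\<close>
    have "closure (convex_cone hull ND) \<times> {0} = closure ((convex_cone hull ND) \<times> {0::real})"
      by (simp add: closure_Times closure_closed[OF closed_singleton])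
    also have "\<dots> \<subseteq> closure (convex_cone hull N)"
    proof (rule closure_mono)
      have lin: "linear (\<lambda>w::'a. (w, 0::real))" by (rule linearI) auto
      have "(convex_cone hull ND) \<times> {0} = (\<lambda>w. (w, 0::real)) ` (convex_cone hull ND)" by auto
      also have "\<dots> = convex_cone hull ((\<lambda>w. (w, 0::real)) ` ND)"
        by (rule convex_cone_hull_linear_image[OF lin, symmetric])
      also have "\<dots> \<subseteq> convex_cone hull N"
        by (rule hull_mono) (use \<open>B \<subseteq> N\<close> B_def in auto)
      finally show "(convex_cone hull ND) \<times> {0} \<subseteq> convex_cone hull N" .
    qed
    finally have 2: "(w, 0) \<in> closure (convex_cone hull N)" using w unfolding NDC by auto
    have "(u, -1) + (w, 0) \<in> closure (convex_cone hull N)"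
      by (rule convex_cone_add[OF convex_cone_closure[OF convex_cone_convex_cone_hull] 1 2])
    then show ?thesis
      using fin0 by (simp add: clarke_subdifferential_def Q_eq NC flip: \<phi>_def z_def)
  qed

  \<comment> \<open>Inclusion from left to right\<close>
  have sub: "\<exists>u w. v = u + w \<and> u \<in> (\<Inter>\<delta>\<in>{0<..}. closure (convex hull G \<delta>)) \<and> w \<in> clarke_normal_cone D x0"
    if v: "v \<in> clarke_subdifferential f x0" for v
  proof -
    have vN: "(v, -1) \<in> closure (convex_cone hull N)"
      using v by (simp add: clarke_subdifferential_def Q_eq NC flip: \<phi>_def z_def)
    have A_mono: "A \<delta> \<subseteq> A \<delta>'" if "\<delta> \<le> \<delta>'" for \<delta> \<delta>'
      unfolding A_def G_def using that by (intro hull_mono Sigma_mono gradients_mono) auto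
    have A_scale: "t *\<^sub>R x \<in> A \<delta>" if "x \<in> A \<delta>" "0 \<le> t" for x t \<delta>
      unfolding A_def using that conicD[OF conic_conic_hull] by (simp add: A_def)
    have "closed (A0 \<union> B)"
      unfolding A0_def B_def ND_def
      by (intro closed_Un closed_INT ballI closed_Times closed_limiting_normal_cone) auto
    moreover have "conic (A0 \<union> B)"
    proof -
      have "conic A0" unfolding A0_def by (rule conic_Inter_closure) (rule A_scale)
      moreover have "conic B"
        using conic_limiting_normal_cone[of D x0] by (auto simp: B_def ND_def conic_def)
      ultimately show ?thesis by (auto simp: conic_def)
    qed
    ultimately have AB: "closed (A0 \<union> B)" "conic (A0 \<union> B)" by auto
    have "(v, -1) \<in> convex_cone hull (A0 \<union> B)"
    proof (rule ccontr)
      assume out: "(v, -1) \<notin> convex_cone hull (A0 \<union> B)"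
      \<comment> \<open>Both cones consist of normals at z, so the direction e serves for them too
        and yields a strict separator.\<close>
      have e_AB: "e \<bullet> n < 0" if "n \<in> A0 \<union> B" "n \<noteq> 0" for n
        using e that \<open>A0 \<subseteq> N\<close> \<open>B \<subseteq> N\<close> by blast
      obtain d where d: "\<And>n. n \<in> A0 \<union> B \<Longrightarrow> n \<noteq> 0 \<Longrightarrow> d \<bullet> n < 0" "d \<bullet> (v, -1) > 0" "snd d \<noteq> 0"
        using separation_nonhorizontal[OF AB e_AB out] by blast
      have "d \<bullet> a < 0" if "a \<in> (\<Inter>\<delta>\<in>{0<..}. closure (A \<delta>))" "a \<noteq> 0" for a
        using d(1) that by (auto simp: A0_def)
      from cone_gap[of A d, OF A_mono A_scale this]
      obtain c\<^sub>A \<delta>\<^sub>A where "c\<^sub>A > 0" "\<delta>\<^sub>A > 0" and gapA: "\<And>a. a \<in> A \<delta>\<^sub>A \<Longrightarrow> d \<bullet> a \<le> - c\<^sub>A * norm a"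
        by blast
      have "fst d \<bullet> w < 0" if "w \<in> limiting_normal_cone D x0" "w \<noteq> 0" for w
        using d(1)[of "(w, 0)"] that by (cases d) (auto simp: B_def ND_def zero_prod_def)
      from limiting_normal_cone_gap[OF \<open>x0 \<in> D\<close> this]
      obtain c\<^sub>B \<delta>\<^sub>B where "c\<^sub>B > 0" "\<delta>\<^sub>B > 0"
        and gapB: "\<And>w. w \<in> near_normals D x0 \<delta>\<^sub>B \<Longrightarrow> fst d \<bullet> w \<le> - c\<^sub>B * norm w"
        by blast
      obtain c\<^sub>e \<delta>\<^sub>e where "c\<^sub>e > 0" "\<delta>\<^sub>e > 0"
        and gape: "\<And>n. n \<in> near_normals Q z \<delta>\<^sub>e \<Longrightarrow> e \<bullet> n \<le> - c\<^sub>e * norm n"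
        using limiting_normal_cone_gap[OF zQ e[unfolded N_def]] by blast
      obtain \<M> where \<M>: "locally_finite_stratification D \<M>"
        and C2: "\<And>M. M \<in> \<M> \<Longrightarrow> C2_smooth_on_stratum f M"
        using strat unfolding stratifiable_def D_def by blast
      \<comment> \<open>The shear by \<open>fst d /\<^sub>R snd d\<close> sends x to the trace at
        height 0 of the line through (x, \<phi> x) in direction d.\<close>
      obtain \<delta>\<^sub>Z Z where "\<delta>\<^sub>Z > 0" "negligible Z"
        and smooth: "\<And>x. x \<in> D \<inter> ball x0 \<delta>\<^sub>Z \<Longrightarrow> x - \<phi> x *\<^sub>R (fst d /\<^sub>R snd d) \<notin> Z \<Longrightarrow>
          \<exists>W \<gamma>. open W \<and> x \<in> W \<and> W \<subseteq> D \<and> (\<forall>y\<in>W. \<bar>f y\<bar> \<noteq> \<infinity>) \<and>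
            (\<forall>y\<in>W. (\<phi> has_derivative (\<lambda>h. h \<bullet> \<gamma> y)) (at y)) \<and> continuous_on UNIV \<gamma>"
        by (rule stratified_smooth_off_negligible[OF \<M> C2 \<open>x0 \<in> D\<close>, of "fst d /\<^sub>R snd d",
            folded \<phi>_def[abs_def] \<phi>_def], assumption) (rule that)
      obtain \<delta>\<^sub>U where "\<delta>\<^sub>U > 0" "ball x0 \<delta>\<^sub>U \<subseteq> U"
        using \<open>open U\<close> \<open>x0 \<in> U\<close> open_contains_ball by blast
      obtain \<delta>\<^sub>Q where "\<delta>\<^sub>Q > 0" "closed (Q \<inter> cball z \<delta>\<^sub>Q)"
        using dirlip unfolding directionally_lipschitzian_at_def locally_lsc_at_def
          locally_closed_at_def Q_eq z_def \<phi>_def by blast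
      define \<epsilon> where "\<epsilon> = Min {\<delta>\<^sub>A, \<delta>\<^sub>B, \<delta>\<^sub>e, \<delta>\<^sub>Z, \<delta>\<^sub>U, \<delta>\<^sub>Q}"
      have "\<epsilon> > 0"
        unfolding \<epsilon>_def using \<open>\<delta>\<^sub>A > 0\<close> \<open>\<delta>\<^sub>B > 0\<close> \<open>\<delta>\<^sub>e > 0\<close> \<open>\<delta>\<^sub>Z > 0\<close> \<open>\<delta>\<^sub>U > 0\<close> \<open>\<delta>\<^sub>Q > 0\<close> by simp
      have \<epsilon>_le: "\<epsilon> \<le> \<delta>\<^sub>A" "\<epsilon> \<le> \<delta>\<^sub>B" "\<epsilon> \<le> \<delta>\<^sub>e" "\<epsilon> \<le> \<delta>\<^sub>Z" "\<epsilon> \<le> \<delta>\<^sub>U" "\<epsilon> \<le> \<delta>\<^sub>Q"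
        unfolding \<epsilon>_def by (auto intro: Min_le)
      obtain \<eta> where "\<eta> > 0"
        and ray: "\<And>y s. y \<in> Q \<inter> ball z \<eta> \<Longrightarrow> 0 < s \<Longrightarrow> s \<le> \<eta> \<Longrightarrow> y + s *\<^sub>R d \<in> Q"
        unfolding Q_def
      proof (rule epigraph_recession[of D \<phi> z \<epsilon> c\<^sub>e e d Z])
        show "closed (real_epigraph D \<phi> \<inter> cball z \<epsilon>)"
        proof -
          have "Q \<inter> cball z \<epsilon> = (Q \<inter> cball z \<delta>\<^sub>Q) \<inter> cball z \<epsilon>" using \<epsilon>_le(6) by auto
          then show ?thesis
            using \<open>closed (Q \<inter> cball z \<delta>\<^sub>Q)\<close> by (simp add: closed_Int flip: Q_def)
        qed
        show "continuous (at y within D) \<phi>" if "y \<in> D \<inter> ball (fst z) \<epsilon>" for y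
          using that \<epsilon>_le(5) \<open>ball x0 \<delta>\<^sub>U \<subseteq> U\<close> by (intro cont_\<phi>) (force simp: z_def)
        show "e \<bullet> n \<le> - c\<^sub>e * norm n" if "n \<in> near_normals (real_epigraph D \<phi>) z \<epsilon>" for n
          using gape that near_normals_mono[OF \<epsilon>_le(3)] unfolding Q_def by blast
        show "fst d \<bullet> w \<le> 0" if "w \<in> near_normals D (fst z) \<epsilon>" for w
        proof -
          have "w \<in> near_normals D x0 \<delta>\<^sub>B" using that near_normals_mono[OF \<epsilon>_le(2)] by (auto simp: z_def)
          then have "fst d \<bullet> w \<le> - c\<^sub>B * norm w" by (rule gapB)
          also have "\<dots> \<le> 0" using \<open>c\<^sub>B > 0\<close> by simp
          finally show ?thesis .
        qed
        fix y assume y: "y \<in> D \<inter> ball (fst z) \<epsilon>" and yZ: "y - (\<phi> y / snd d) *\<^sub>R fst d \<notin> Z"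
        have yb: "y \<in> ball x0 \<delta>\<^sub>Z" "y \<in> ball x0 \<delta>\<^sub>A" using y \<epsilon>_le by (auto simp: z_def)
        have "y - \<phi> y *\<^sub>R (fst d /\<^sub>R snd d) \<notin> Z" using yZ by (simp add: divide_inverse)
        with smooth[of y] y yb obtain W \<gamma> where W: "open W" "y \<in> W" "W \<subseteq> D"
          "\<forall>y\<in>W. \<bar>f y\<bar> \<noteq> \<infinity>" "\<forall>y\<in>W. (\<phi> has_derivative (\<lambda>h. h \<bullet> \<gamma> y)) (at y)" "continuous_on UNIV \<gamma>"
          by blast
        have "\<gamma> y \<in> closure (G \<delta>\<^sub>A)"
          unfolding G_def
          by (rule dense_gradient_near[OF W(1-3) _ _ W(6) \<Omega>D(2) yb(2)])
            (use W(4,5) in \<open>auto simp: \<phi>_def[abs_def]\<close>)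
        \<comment> \<open>The vector (g, -1) has norm at least 1, so the gap leaves a margin of
          \<open>c\<^sub>A\<close>; it survives the closure and keeps the inequality strict at
          \<open>\<gamma> y\<close>.\<close>
        moreover have "closure (G \<delta>\<^sub>A) \<subseteq> {g. fst d \<bullet> g \<le> snd d - c\<^sub>A}"
        proof (intro closure_minimal closed_halfspace_le subsetI CollectI)
          fix g assume "g \<in> G \<delta>\<^sub>A"
          then have "(g, -1) \<in> A \<delta>\<^sub>A" unfolding A_def by (intro hull_inc) simp
          then have "d \<bullet> (g, -1) \<le> - c\<^sub>A * norm (g, -1::real)" by (rule gapA)
          also have "\<dots> \<le> - c\<^sub>A * 1"
            using \<open>c\<^sub>A > 0\<close> norm_snd_le[of "-1::real" g] by (intro mult_left_mono_neg) auto
          finally show "fst d \<bullet> g \<le> snd d - c\<^sub>A" by (cases d) simp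
        qed
        ultimately have "fst d \<bullet> \<gamma> y < snd d" using \<open>c\<^sub>A > 0\<close> by auto
        moreover have "y \<in> interior D" using W(1-3) interior_maximal by blast
        ultimately show "y \<in> interior D \<and> (\<exists>g. (\<phi> has_derivative (\<lambda>h. h \<bullet> g)) (at y) \<and> fst d \<bullet> g < snd d)"
          using W(2,5) by blast
      next
        fix \<eta> :: real
        assume "\<eta> > 0" "\<And>y s. y \<in> real_epigraph D \<phi> \<inter> ball z \<eta> \<Longrightarrow> 0 < s \<Longrightarrow> s \<le> \<eta> \<Longrightarrow>
          y + s *\<^sub>R d \<in> real_epigraph D \<phi>"
        then show thesis by (rule that[unfolded Q_def])
      qed (use \<open>\<epsilon> > 0\<close> \<open>c\<^sub>e > 0\<close> d(3) \<open>negligible Z\<close> in auto)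
      \<comment> \<open>Rays in direction d remain in Q, so d is nonpositive on nearby normals, then
        on N and on the Clarke cone, against d \<bullet> (v, -1) > 0.\<close>
      have "near_normals Q z \<eta> \<subseteq> {n. d \<bullet> n \<le> 0}"
      proof
        fix n assume "n \<in> near_normals Q z \<eta>"
        then obtain y where y: "y \<in> Q \<inter> ball z \<eta>" and n: "n \<in> frechet_normal_cone Q y"
          unfolding near_normals_def by blast
        show "n \<in> {n. d \<bullet> n \<le> 0}"
          using frechet_normal_nonpos_along_ray[OF n \<open>\<eta> > 0\<close> ray[OF y]] by simp
      qed
      then have "closure (near_normals Q z \<eta>) \<subseteq> {n. d \<bullet> n \<le> 0}"
        by (intro closure_minimal closed_halfspace_le)
      then have "N \<subseteq> {n. d \<bullet> n \<le> 0}" unfolding N_eq using \<open>\<eta> > 0\<close> by blast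
      then have "closure (convex_cone hull N) \<subseteq> {n. d \<bullet> n \<le> 0}"
        by (intro closure_minimal hull_minimal convex_cone_halfspace_le closed_halfspace_le)
      then show False using vN d(2) by auto
    qed
    then obtain a b where ab: "(v, -1) = a + b" "a \<in> convex_cone hull A0" "b \<in> convex_cone hull B"
      unfolding convex_cone_hull_Un by blast
    \<comment> \<open>The part from B is horizontal, so the part from A0 has height -1; its first
      component v - w is the required u.\<close>
    have "convex_cone hull B \<subseteq> (convex_cone hull ND) \<times> {0}"
      unfolding B_def
      by (intro hull_minimal Sigma_mono hull_subset order_refl)
        (simp add: convex_cone_Times convex_cone_convex_cone_hull)
    then obtain w where b: "b = (w, 0)" "w \<in> convex_cone hull ND" using ab(3) by blast
    have a: "a = (v - w, -1)" using ab(1) b(1) by (cases a) auto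
    \<comment> \<open>For each \<delta>, A0 lies in the closed convex cone generated by
      \<open>G \<delta> \<times> {-1}\<close>, whose slice at height -1 is the closed convex hull of
      \<open>G \<delta>\<close>.\<close>
    have "v - w \<in> closure (convex hull G \<delta>)" if "\<delta> > 0" for \<delta>
    proof (rule closure_hull_horizontal_slice)
      have "A \<delta> \<subseteq> convex_cone hull (G \<delta> \<times> {-1})"
        unfolding A_def by (rule conic_hull_subset_convex_cone_hull)
      then have "A0 \<subseteq> closure (convex_cone hull (G \<delta> \<times> {-1}))"
        unfolding A0_def using that closure_mono by blast
      then have "convex_cone hull A0 \<subseteq> closure (convex_cone hull (G \<delta> \<times> {-1}))"
        by (intro hull_minimal convex_cone_closure convex_cone_convex_cone_hull)
      then show "(v - w, -1) \<in> closure (convex_cone hull (G \<delta> \<times> {-1::real}))"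
        using ab(2) unfolding a by (rule subsetD)
    qed
    moreover have "w \<in> clarke_normal_cone D x0" unfolding NDC using b(2) closure_subset by blast
    ultimately show ?thesis by (intro exI[of _ "v - w"] exI[of _ w]) auto
  qed

  show ?thesis
    using super sub unfolding G_def D_def by blast
qed

theorem corollary3p11:
  fixes f :: "real ^ 'n \<Rightarrow> ereal" and xbar :: "real ^ 'n" and \<Omega> :: "(real ^ 'n) set"
  assumes "proper_function f"
    and "stratifiable f"
    and "\<bar>f xbar\<bar> \<noteq> \<infinity>"
    and "\<exists>V. open V \<and> xbar \<in> V \<and>
           (\<forall>x\<in>V \<inter> effective_domain f. directionally_lipschitzian_at f x)"
    and "\<exists>U. open U \<and> xbar \<in> U \<and>
           (\<forall>x\<in>U \<inter> effective_domain f. continuous (at x within effective_domain f) f)"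
    and "\<Omega> \<subseteq> effective_domain f"
    and "effective_domain f \<subseteq> closure \<Omega>"
  shows "clarke_subdifferential f xbar =
    {u + w | u w.
       u \<in> (\<Inter>\<delta>\<in>{0<..}. closure (convex hull (gradients f (\<Omega> \<inter> ball xbar \<delta>)))) \<and>
       w \<in> clarke_normal_cone (effective_domain f) xbar}"
proof -
  have "xbar \<in> effective_domain f" using assms(3) by (cases "f xbar") (auto simp: effective_domain_def)
  then have "directionally_lipschitzian_at f xbar" using assms(4) by blast
  moreover obtain U where "open U" "xbar \<in> U"
    "\<And>x. x \<in> U \<inter> effective_domain f \<Longrightarrow> continuous (at x within effective_domain f) f"
    using assms(5) by blast
  ultimately show ?thesis
    using assms by (intro clarke_subdifferential_gradient_formula)
qed

end
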